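(* Let $\Lambda=\{1,\dots,N\}$ with $N\ge2$, $\delta_i>0$ for $i\in\Lambda$, and $\gamma:\Lambda\times\Lambda\to[0,+\infty]$ with $\gamma_{ij}=\gamma_{ji}$, $\gamma_{ii}=0$. Let $P$ be the Gibbs measure on $\mathbb{N}^\Lambda$ $$P(x_1,\dots,x_N)=\frac1C\,\mathrm{e}^{-\sum_{i<j}\gamma_{ij}x_ix_j}\prod_{i=1}^N\mathcal{P}(\delta_i)(x_i),$$ with $C$ the normalizing constant. Assume Dobrushin's uniqueness condition $$D:=\sup_{j\in\Lambda}\sum_{i\in\Lambda}\delta_i(1-\mathrm{e}^{-\gamma_{ij}})<1.$$ Let $\rho_H(x_\Lambda,y_\Lambda)=\sum_{i\in\Lambda}|x_i-y_i|$ on $\mathbb{N}^\Lambda$ and $c=\sum_{i\in\Lambda}(\delta_i+\delta_i^2/4)$. Then $$h_c\big((1-D)\,W_{1,\rho_H}(Q,P)\big)\le H(Q|P)\qquad\text{for all }Q\in\mathcal{M}_1(\mathbb{N}^\Lambda).$$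
   Context: Conventions: $0\cdot\infty=0$, $\mathrm{e}^{-\infty}=0$. $\mathcal{P}(\lambda)(k)=\mathrm{e}^{-\lambda}\lambda^k/k!$. $W_{1,d}(\mu,\nu)=\inf_\pi\int\!\!\int d(x,y)\,\mathrm{d}\pi(x,y)$ over couplings $\pi$ of $\mu,\nu$. $H(\nu|\mu)=\int\log\frac{\mathrm{d}\nu}{\mathrm{d}\mu}\,\mathrm{d}\nu$ if $\nu\ll\mu$, $+\infty$ otherwise. $h(r)=(1+r)\log(1+r)-r$, $h_c(r)=c\,h(r/c)$ for $c>0$. *)

theory Defs
  imports "HOL-Probability.Probability"
begin

definition conf :: "nat \<Rightarrow> (nat \<Rightarrow> nat) set" where
  "conf N = {x. \<forall>i. i \<notin> {1..N} \<longrightarrow> x i = 0}"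

definition exp_neg :: "ereal \<Rightarrow> real" where
  "exp_neg e = (if e = \<infinity> then 0 else exp (- real_of_ereal e))"

definition poisson_w :: "real \<Rightarrow> nat \<Rightarrow> real" where
  "poisson_w l k = exp (- l) * l ^ k / fact k"

text \<open>Interaction energy sum_{i<j} gamma_ij x_i x_j (with 0 * inf = 0).\<close>
definition energy :: "nat \<Rightarrow> (nat \<Rightarrow> nat \<Rightarrow> ereal) \<Rightarrow> (nat \<Rightarrow> nat) \<Rightarrow> ereal" where
  "energy N \<gamma> x = (\<Sum>(i,j)\<in>{(i,j). i \<in> {1..N} \<and> j \<in> {1..N} \<and> i < j}. \<gamma> i j * ereal (real (x i * x j)))"

definition gibbs_weight :: "nat \<Rightarrow> (nat \<Rightarrow> real) \<Rightarrow> (nat \<Rightarrow> nat \<Rightarrow> ereal) \<Rightarrow> (nat \<Rightarrow> nat) \<Rightarrow> real" where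
  "gibbs_weight N \<delta> \<gamma> x = exp_neg (energy N \<gamma> x) * (\<Prod>i\<in>{1..N}. poisson_w (\<delta> i) (x i))"

definition gibbs_const :: "nat \<Rightarrow> (nat \<Rightarrow> real) \<Rightarrow> (nat \<Rightarrow> nat \<Rightarrow> ereal) \<Rightarrow> real" where
  "gibbs_const N \<delta> \<gamma> = (\<Sum>\<^sub>\<infinity>x\<in>conf N. gibbs_weight N \<delta> \<gamma> x)"

definition gibbs_pmf :: "nat \<Rightarrow> (nat \<Rightarrow> real) \<Rightarrow> (nat \<Rightarrow> nat \<Rightarrow> ereal) \<Rightarrow> (nat \<Rightarrow> nat) pmf" where
  "gibbs_pmf N \<delta> \<gamma> = embed_pmf (\<lambda>x. if x \<in> conf N then gibbs_weight N \<delta> \<gamma> x / gibbs_const N \<delta> \<gamma> else 0)"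

definition dobrushin :: "nat \<Rightarrow> (nat \<Rightarrow> real) \<Rightarrow> (nat \<Rightarrow> nat \<Rightarrow> ereal) \<Rightarrow> real" where
  "dobrushin N \<delta> \<gamma> = (SUP j\<in>{1..N}. \<Sum>i\<in>{1..N}. \<delta> i * (1 - exp_neg (\<gamma> i j)))"

definition hamming_dist :: "nat \<Rightarrow> (nat \<Rightarrow> nat) \<Rightarrow> (nat \<Rightarrow> nat) \<Rightarrow> real" where
  "hamming_dist N x y = (\<Sum>i\<in>{1..N}. \<bar>real (x i) - real (y i)\<bar>)"

definition couplings :: "'a pmf \<Rightarrow> 'b pmf \<Rightarrow> ('a \<times> 'b) pmf set" where
  "couplings \<mu> \<nu> = {\<pi>. map_pmf fst \<pi> = \<mu> \<and> map_pmf snd \<pi> = \<nu>}"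

definition wasserstein1 :: "('a \<Rightarrow> 'a \<Rightarrow> real) \<Rightarrow> 'a pmf \<Rightarrow> 'a pmf \<Rightarrow> ennreal" where
  "wasserstein1 d \<mu> \<nu> = (INF \<pi>\<in>couplings \<mu> \<nu>. \<integral>\<^sup>+ p. ennreal (d (fst p) (snd p)) \<partial>measure_pmf \<pi>)"

definition rel_entropy :: "'a pmf \<Rightarrow> 'a pmf \<Rightarrow> ereal" where
  "rel_entropy \<nu> \<mu> =
     (if set_pmf \<nu> \<subseteq> set_pmf \<mu> then
        (let f = (\<lambda>x. ln (pmf \<nu> x / pmf \<mu> x)) in
          enn2ereal (\<integral>\<^sup>+ x. ennreal (f x) \<partial>measure_pmf \<nu>)
          - enn2ereal (\<integral>\<^sup>+ x. ennreal (- f x) \<partial>measure_pmf \<nu>))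
      else \<infinity>)"

definition hfun :: "real \<Rightarrow> real" where
  "hfun r = (1 + r) * ln (1 + r) - r"

definition hc_ext :: "real \<Rightarrow> ennreal \<Rightarrow> ereal" where
  "hc_ext c r = (if r = \<infinity> then \<infinity> else ereal (c * hfun (enn2real r / c)))"

end

theory Submission
  imports Defs
begin

text \<open>
  Reveal the sites one at a time. Given the value \<open>n\<close> at site \<open>k\<close>, the remaining sites form a
  Gibbs measure with the smaller intensities \<open>\<delta>\<^sub>i exp (- n \<gamma>\<^sub>k\<^sub>i)\<close>. Dobrushin's condition gives
  a comparison: for two such measures, whose intensities differ by \<open>b\<close> in total, the
  transport cost is at most \<open>b / (1 - D)\<close>; for if every site of a nearly optimal coupling is
  resampled from optimally coupled Poisson laws, the cost cannot drop below the infimum.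
  Hence changing \<open>n\<close> by one moves the rest by at most \<open>D / (1 - D)\<close>, and moving one unit at a site
  costs at most \<open>1 / (1 - D)\<close> altogether.

  The marginal at a site is a mixture of Poisson laws with intensities in \<open>[0, \<delta>\<^sub>i]\<close>. For a
  1-Lipschitz function the Poisson fluctuations contribute \<open>\<delta>\<^sub>i (exp l - 1 - l)\<close> to the
  log-Laplace transform, and Hoeffding's lemma bounds the fluctuations of the intensity by
  \<open>l\<^sup>2 \<delta>\<^sub>i\<^sup>2 / 8\<close>; this is the origin of \<open>\<delta>\<^sub>i + \<delta>\<^sub>i\<^sup>2 / 4\<close>.

  Instead of the chain rule for the relative entropy, the induction uses test functions: the
  transport cost is bounded by the supremum of \<open>E\<^sub>Q G\<close> over bounded \<open>G\<close> with
  \<open>E\<^sub>P exp G \<le> exp \<kappa>\<close>, and test functions for the successive sites simply add up. Entropy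
  enters once, at the end, through the Donsker--Varadhan inequality.
\<close>

section \<open>Expectations and conditioning\<close>

text \<open>Gibbs measures with arbitrary nonnegative intensities form a class closed under
  conditioning on a site, and conditioning only lowers the intensities; hence neither Dobrushin's
  sums nor the constants grow along the induction. In the comparison the sites are resampled
  separately, each time starting from the same coupling, and the resulting inequalities are added.
  Since only nearly optimal couplings are at hand, the transport cost must be known to be finite,
  and the argument closes only in the limit. The factor 1 - D is carried along as a multiplier: one
  unit at the current site contributes 1 - D directly and at most D through the remaining sites,
  together 1, which is the plain one-dimensional cost. Because l^2 / 2 \<le> exp l - 1 - l for l
  \<ge> 0, Hoeffding's term fits the Poisson rate function, so all sites have a bound of the same
  shape and their coefficients add up to c. What remains is l (1 - D) W \<le> H + c (exp l - 1 - l)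
  for all l \<ge> 0, and the best l yields h_c((1 - D) W) \<le> H.\<close>

lemma integrable_measure_pmf_bounded:
  fixes f :: "'a \<Rightarrow> real"
  assumes "\<And>x. \<bar>f x\<bar> \<le> B"
  shows "integrable (measure_pmf p) f"
  by (rule measure_pmf.integrable_const_bound[where B = B]) (use assms in auto)

lemma abs_expectation_le:
  fixes f :: "'a \<Rightarrow> real"
  assumes B: "\<And>x. \<bar>f x\<bar> \<le> B"
  shows "\<bar>measure_pmf.expectation p f\<bar> \<le> B"
proof -
  have "B \<ge> 0" using B[of undefined] by linarith
  have "\<bar>measure_pmf.expectation p f\<bar> \<le> measure_pmf.expectation p (\<lambda>x. \<bar>f x\<bar>)"
    by (rule integral_abs_bound)
  also have "\<dots> \<le> measure_pmf.expectation p (\<lambda>x. B)"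
    by (intro integral_mono) (use B in \<open>auto intro!: integrable_measure_pmf_bounded[where B=B]\<close>)
  finally show ?thesis by simp
qed

text \<open>Shifting by \<open>B\<close> makes the integrand nonnegative; the tower property then
  comes from the one for \<open>\<integral>\<^sup>+\<close>.\<close>

lemma expectation_bind_pmf:
  fixes f :: "'a \<Rightarrow> real"
  assumes B: "\<And>x. \<bar>f x\<bar> \<le> B"
  shows "measure_pmf.expectation (bind_pmf p K) f
       = measure_pmf.expectation p (\<lambda>n. measure_pmf.expectation (K n) f)"
proof -
  note I = integrable_measure_pmf_bounded[OF B]
  have f0: "0 \<le> f x + B" for x using B[of x] by linarith
  have nn: "(\<integral>\<^sup>+x. ennreal (f x + B) \<partial>measure_pmf M) = ennreal (measure_pmf.expectation M f + B)" for M
    using nn_integral_eq_integral[of "measure_pmf M" "\<lambda>x. f x + B"] f0 I[of M] by simp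
  have E0: "0 \<le> measure_pmf.expectation M f + B" for M
    using abs_expectation_le[of f B M] B by force
  have I': "integrable (measure_pmf p) (\<lambda>n. measure_pmf.expectation (K n) f)"
    by (rule integrable_measure_pmf_bounded) (rule abs_expectation_le[OF B])
  have "ennreal (measure_pmf.expectation (bind_pmf p K) f + B)
      = (\<integral>\<^sup>+n. ennreal (measure_pmf.expectation (K n) f + B) \<partial>measure_pmf p)"
    unfolding nn[symmetric] by simp
  also have "\<dots> = ennreal (measure_pmf.expectation p (\<lambda>n. measure_pmf.expectation (K n) f) + B)"
    using nn_integral_eq_integral[of "measure_pmf p" "\<lambda>n. measure_pmf.expectation (K n) f + B"] E0 I' by simp
  finally have *: "ennreal (measure_pmf.expectation (bind_pmf p K) f + B)
      = ennreal (measure_pmf.expectation p (\<lambda>n. measure_pmf.expectation (K n) f) + B)" .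
  have "0 \<le> measure_pmf.expectation p (\<lambda>n. measure_pmf.expectation (K n) f) + B"
    using abs_expectation_le[of "\<lambda>n. measure_pmf.expectation (K n) f" B p] abs_expectation_le[OF B] by force
  with * E0 show ?thesis by simp
qed

text \<open>Lets Gibbs measures and their conditional laws be identified from unnormalised weights,
  so that normalising constants need not be compared.\<close>

lemma pmf_proportional_unique:
  assumes \<mu>: "\<And>x. pmf \<mu> x = c * w x" and \<nu>: "\<And>x. pmf \<nu> x = c' * w x"
  shows "\<mu> = \<nu>"
proof -
  obtain x where "x \<in> set_pmf \<nu>" using set_pmf_not_empty by fast
  hence "c' \<noteq> 0" using \<nu>[of x] by (auto simp: set_pmf_iff)
  obtain z where "z \<in> set_pmf \<mu>" using set_pmf_not_empty by fast
  hence z: "pmf \<mu> z > 0" by (simp add: pmf_positive)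
  define r where "r = c / c'"
  have r: "pmf \<mu> x = r * pmf \<nu> x" for x
    using \<open>c' \<noteq> 0\<close> by (simp add: \<mu> \<nu> r_def)
  have "r \<ge> 0" using r[of z] z pmf_nonneg[of \<nu> z] by (metis less_eq_real_def mult_nonpos_nonneg not_le)
  have "1 = (\<integral>\<^sup>+x. ennreal (pmf \<mu> x) \<partial>count_space UNIV)"
    by (simp add: nn_integral_pmf measure_pmf.emeasure_space_1[simplified])
  also have "\<dots> = ennreal r * (\<integral>\<^sup>+x. ennreal (pmf \<nu> x) \<partial>count_space UNIV)"
    unfolding r using \<open>r \<ge> 0\<close> by (simp add: ennreal_mult nn_integral_cmult)
  also have "\<dots> = ennreal r"
    by (simp add: nn_integral_pmf measure_pmf.emeasure_space_1[simplified])
  finally have "r = 1" by (metis ennreal_1 ennreal_eq_1)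
  thus ?thesis using r by (intro pmf_eqI) simp
qed

lemma bind_cond_pmf_fibre:
  "bind_pmf (map_pmf f \<mu>) (\<lambda>b. cond_pmf \<mu> {x. f x = b}) = \<mu>"
proof -
  have "bind_pmf (map_pmf f \<mu>) (\<lambda>b. cond_pmf \<mu> {x. b = f x}) = \<mu>"
    by (rule bind_cond_pmf_cancel) (auto simp: vimage_def eq_commute)
  thus ?thesis by (simp add: eq_commute)
qed

section \<open>Couplings and transport cost\<close>

abbreviation transport_cost :: "('a \<Rightarrow> 'a \<Rightarrow> real) \<Rightarrow> ('a \<times> 'a) pmf \<Rightarrow> ennreal" where
  "transport_cost d \<pi> \<equiv> \<integral>\<^sup>+ p. ennreal (d (fst p) (snd p)) \<partial>measure_pmf \<pi>"

lemma wasserstein1_le: "\<pi> \<in> couplings \<mu> \<nu> \<Longrightarrow> wasserstein1 d \<mu> \<nu> \<le> transport_cost d \<pi>"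
  unfolding wasserstein1_def by (rule INF_lower)

text \<open>Replaces optimal couplings throughout. Finiteness matters: only below \<open>top\<close>
  does adding \<open>e\<close> strictly increase the infimum.\<close>

lemma wasserstein1_near_optimal:
  assumes "0 < e" and "wasserstein1 d \<mu> \<nu> < top"
  shows "\<exists>\<pi>\<in>couplings \<mu> \<nu>. transport_cost d \<pi> \<le> wasserstein1 d \<mu> \<nu> + ennreal e"
proof -
  have "wasserstein1 d \<mu> \<nu> < wasserstein1 d \<mu> \<nu> + ennreal e"
    using assms by (cases "wasserstein1 d \<mu> \<nu>") (auto simp flip: ennreal_plus simp: ennreal_less_iff)
  thus ?thesis unfolding wasserstein1_def INF_less_iff by (meson less_imp_le)
qed

lemma bind_pmf_couplings:
  assumes \<pi>: "\<pi> \<in> couplings q p"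
    and K: "\<And>n m. (n, m) \<in> set_pmf \<pi> \<Longrightarrow> K (n, m) \<in> couplings (Q n) (P m)"
  shows "bind_pmf \<pi> K \<in> couplings (bind_pmf q Q) (bind_pmf p P)"
proof -
  have "map_pmf fst (bind_pmf \<pi> K) = bind_pmf \<pi> (\<lambda>nm. Q (fst nm))"
    unfolding map_bind_pmf by (rule bind_pmf_cong) (use K in \<open>auto simp: couplings_def\<close>)
  also have "\<dots> = bind_pmf (map_pmf fst \<pi>) Q" by (simp add: bind_map_pmf)
  finally have 1: "map_pmf fst (bind_pmf \<pi> K) = bind_pmf q Q" using \<pi> by (simp add: couplings_def)
  have "map_pmf snd (bind_pmf \<pi> K) = bind_pmf \<pi> (\<lambda>nm. P (snd nm))"
    unfolding map_bind_pmf by (rule bind_pmf_cong) (use K in \<open>auto simp: couplings_def\<close>)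
  also have "\<dots> = bind_pmf (map_pmf snd \<pi>) P" by (simp add: bind_map_pmf)
  finally have 2: "map_pmf snd (bind_pmf \<pi> K) = bind_pmf p P" using \<pi> by (simp add: couplings_def)
  from 1 2 show ?thesis by (simp add: couplings_def)
qed

text \<open>Joint convexity of the transport cost: couple the mixing variables by
  \<open>\<pi>\<close>, then glue in nearly optimal couplings of the components. For discrete laws
  choosing these couplings raises no measurability question.\<close>

lemma wasserstein1_bind_pmf:
  assumes \<pi>: "\<pi> \<in> couplings q p"
  shows "wasserstein1 d (bind_pmf q Q) (bind_pmf p P)
     \<le> (\<integral>\<^sup>+nm. wasserstein1 d (Q (fst nm)) (P (snd nm)) \<partial>measure_pmf \<pi>)" (is "_ \<le> ?R")
proof (rule ennreal_le_epsilon)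
  fix e :: real assume "0 < e" and fin: "?R < top"
  have AEfin: "wasserstein1 d (Q (fst nm)) (P (snd nm)) < top" if "nm \<in> set_pmf \<pi>" for nm
    using nn_integral_PInf_AE[of "\<lambda>nm. wasserstein1 d (Q (fst nm)) (P (snd nm))" "measure_pmf \<pi>"] fin that
    by (auto simp: AE_measure_pmf_iff less_top)
  define K where "K nm = (SOME k. k \<in> couplings (Q (fst nm)) (P (snd nm)) \<and>
       transport_cost d k \<le> wasserstein1 d (Q (fst nm)) (P (snd nm)) + ennreal e)" for nm
  have K: "K nm \<in> couplings (Q (fst nm)) (P (snd nm)) \<and>
       transport_cost d (K nm) \<le> wasserstein1 d (Q (fst nm)) (P (snd nm)) + ennreal e" if "nm \<in> set_pmf \<pi>" for nm
  proof -
    have "\<exists>k. k \<in> couplings (Q (fst nm)) (P (snd nm)) \<and>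
       transport_cost d k \<le> wasserstein1 d (Q (fst nm)) (P (snd nm)) + ennreal e"
      using wasserstein1_near_optimal[OF \<open>0 < e\<close> AEfin[OF that]] by (simp add: Bex_def)
    from someI_ex[OF this] show ?thesis by (simp only: K_def)
  qed
  have "wasserstein1 d (bind_pmf q Q) (bind_pmf p P) \<le> transport_cost d (bind_pmf \<pi> K)"
    by (intro wasserstein1_le bind_pmf_couplings[OF \<pi>]) (metis K fst_conv snd_conv)
  also have "\<dots> = (\<integral>\<^sup>+nm. transport_cost d (K nm) \<partial>measure_pmf \<pi>)" by simp
  also have "\<dots> \<le> (\<integral>\<^sup>+nm. wasserstein1 d (Q (fst nm)) (P (snd nm)) + ennreal e \<partial>measure_pmf \<pi>)"
    by (intro nn_integral_mono_AE) (simp add: AE_measure_pmf_iff K)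
  also have "\<dots> = ?R + ennreal e"
    by (subst nn_integral_add) (auto simp: measure_pmf.emeasure_space_1[simplified])
  finally show "wasserstein1 d (bind_pmf q Q) (bind_pmf p P) \<le> ?R + ennreal e" .
qed

text \<open>Gluing: \<open>\<alpha>\<close> and \<open>\<beta>\<close> are joined along their common
  marginal \<open>\<nu>\<close> by drawing the second pair from \<open>\<beta>\<close> conditionally
  on its first entry.\<close>

lemma wasserstein1_triangle:
  assumes d0: "\<And>x y. d x y \<ge> 0" and tri: "\<And>x y z. d x z \<le> d x y + d y z"
  shows "wasserstein1 d \<mu> \<rho> \<le> wasserstein1 d \<mu> \<nu> + wasserstein1 d \<nu> \<rho>"
proof (cases "wasserstein1 d \<mu> \<nu> < top \<and> wasserstein1 d \<nu> \<rho> < top")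
  case True
  show ?thesis
  proof (rule ennreal_le_epsilon)
    fix e :: real assume "0 < e"
    then have e2: "0 < e / 2" by simp
    obtain \<alpha> where \<alpha>: "\<alpha> \<in> couplings \<mu> \<nu>" "transport_cost d \<alpha> \<le> wasserstein1 d \<mu> \<nu> + ennreal (e/2)"
      using wasserstein1_near_optimal[OF e2] True by blast
    obtain \<beta> where \<beta>: "\<beta> \<in> couplings \<nu> \<rho>" "transport_cost d \<beta> \<le> wasserstein1 d \<nu> \<rho> + ennreal (e/2)"
      using wasserstein1_near_optimal[OF e2] True by blast
    define C where "C y = cond_pmf \<beta> {yz. fst yz = y}" for y
    define \<tau> where "\<tau> = bind_pmf \<alpha> (\<lambda>xy. map_pmf (\<lambda>yz. (xy, yz)) (C (snd xy)))"
    have \<beta>C: "bind_pmf \<nu> C = \<beta>"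
      using bind_cond_pmf_fibre[of fst \<beta>] \<beta>(1) by (simp add: couplings_def C_def[abs_def])
    have f\<tau>: "map_pmf fst \<tau> = \<alpha>"
      by (simp add: \<tau>_def map_bind_pmf map_pmf_comp bind_return_pmf')
    have s\<tau>: "map_pmf snd \<tau> = \<beta>"
    proof -
      have "map_pmf snd \<tau> = bind_pmf (map_pmf snd \<alpha>) C"
        by (simp add: \<tau>_def map_bind_pmf map_pmf_comp bind_map_pmf)
      thus ?thesis using \<alpha>(1) \<beta>C by (simp add: couplings_def)
    qed
    \<comment> \<open>Conditioning is meaningful only for \<open>y\<close> in the support of
      \<open>\<nu>\<close>, which is where \<open>\<alpha>\<close> puts its second
      coordinate.\<close>
    have agree: "snd xy = fst yz" if "(xy, yz) \<in> set_pmf \<tau>" for xy yz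
    proof -
      have "xy \<in> set_pmf \<alpha>" and yz: "yz \<in> set_pmf (C (snd xy))" using that by (auto simp: \<tau>_def)
      hence "snd xy \<in> set_pmf \<nu>" using \<alpha>(1) by (auto simp: couplings_def)
      hence "set_pmf \<beta> \<inter> {yz. fst yz = snd xy} \<noteq> {}" using \<beta>(1) by (fastforce simp: couplings_def)
      thus ?thesis using yz by (simp add: C_def)
    qed
    define \<pi> where "\<pi> = map_pmf (\<lambda>t. (fst (fst t), snd (snd t))) \<tau>"
    have "map_pmf fst \<pi> = map_pmf fst (map_pmf fst \<tau>)" "map_pmf snd \<pi> = map_pmf snd (map_pmf snd \<tau>)"
      by (simp_all add: \<pi>_def map_pmf_comp)
    hence "\<pi> \<in> couplings \<mu> \<rho>" using \<alpha>(1) \<beta>(1) by (simp add: f\<tau> s\<tau> couplings_def)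
    hence "wasserstein1 d \<mu> \<rho> \<le> transport_cost d \<pi>" by (rule wasserstein1_le)
    also have "\<dots> = (\<integral>\<^sup>+t. ennreal (d (fst (fst t)) (snd (snd t))) \<partial>\<tau>)" by (simp add: \<pi>_def)
    also have "\<dots> \<le> (\<integral>\<^sup>+t. ennreal (d (fst (fst t)) (snd (fst t))) + ennreal (d (fst (snd t)) (snd (snd t))) \<partial>\<tau>)"
    proof (intro nn_integral_mono_AE, unfold AE_measure_pmf_iff, rule ballI)
      fix t assume "t \<in> set_pmf \<tau>"
      hence "snd (fst t) = fst (snd t)" using agree[of "fst t" "snd t"] by simp
      thus "ennreal (d (fst (fst t)) (snd (snd t)))
         \<le> ennreal (d (fst (fst t)) (snd (fst t))) + ennreal (d (fst (snd t)) (snd (snd t)))"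
        using tri[of "fst (fst t)" "snd (snd t)" "snd (fst t)"]
        by (simp add: d0 ennreal_leI flip: ennreal_plus)
    qed
    also have "\<dots> = transport_cost d (map_pmf fst \<tau>) + transport_cost d (map_pmf snd \<tau>)"
      by (simp add: nn_integral_add)
    also have "\<dots> \<le> (wasserstein1 d \<mu> \<nu> + ennreal (e/2)) + (wasserstein1 d \<nu> \<rho> + ennreal (e/2))"
      unfolding f\<tau> s\<tau> by (intro add_mono \<alpha> \<beta>)
    also have "\<dots> = wasserstein1 d \<mu> \<nu> + wasserstein1 d \<nu> \<rho> + (ennreal (e/2) + ennreal (e/2))"
      by (simp add: ac_simps)
    also have "ennreal (e/2) + ennreal (e/2) = ennreal e"
      using \<open>0 < e\<close> by (simp flip: ennreal_plus)
    finally show "wasserstein1 d \<mu> \<rho> \<le> wasserstein1 d \<mu> \<nu> + wasserstein1 d \<nu> \<rho> + ennreal e" .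
  qed
next
  case False
  hence "wasserstein1 d \<mu> \<nu> + wasserstein1 d \<nu> \<rho> = top"
    using top.not_eq_extremum by fastforce
  thus ?thesis by (metis top_greatest)
qed

section \<open>A dual form of the relative entropy\<close>

text \<open>The constraint on the Laplace transform replaces the subtracted logarithm of the
  Donsker-Varadhan formula, so that values of test functions simply add. The sign condition keeps
  \<open>ennreal\<close> from truncating the expectation.\<close>

definition entropy_admissible :: "'a pmf \<Rightarrow> 'a pmf \<Rightarrow> real \<Rightarrow> ('a \<Rightarrow> real) set" where
  "entropy_admissible q p \<kappa> = {G. (\<exists>B. \<forall>x. \<bar>G x\<bar> \<le> B) \<and> measure_pmf.expectation p (\<lambda>x. exp (G x)) \<le> exp \<kappa>
       \<and> 0 \<le> measure_pmf.expectation q G}"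

text \<open>For \<open>\<kappa> \<ge> 0\<close> this is the relative entropy of \<open>q\<close> with respect to \<open>p\<close> plus \<open>\<kappa>\<close>.\<close>

definition entropy_dual :: "'a pmf \<Rightarrow> 'a pmf \<Rightarrow> real \<Rightarrow> ennreal" where
  "entropy_dual q p \<kappa> = (SUP G\<in>entropy_admissible q p \<kappa>. ennreal (measure_pmf.expectation q G))"

lemma entropy_admissibleD:
  assumes "G \<in> entropy_admissible q p \<kappa>"
  shows "\<exists>B. \<forall>x. \<bar>G x\<bar> \<le> B" "measure_pmf.expectation p (\<lambda>x. exp (G x)) \<le> exp \<kappa>"
    "0 \<le> measure_pmf.expectation q G"
  using assms by (auto simp: entropy_admissible_def)

lemma le_entropy_dual:
  assumes "\<And>x. \<bar>G x\<bar> \<le> B" "measure_pmf.expectation p (\<lambda>x. exp (G x)) \<le> exp \<kappa>"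
  shows "ennreal (measure_pmf.expectation q G) \<le> entropy_dual q p \<kappa>"
proof (cases "0 \<le> measure_pmf.expectation q G")
  case True
  thus ?thesis unfolding entropy_dual_def by (intro SUP_upper) (use assms in \<open>auto simp: entropy_admissible_def\<close>)
qed (auto simp: ennreal_neg)

lemma entropy_dual_mono: "\<kappa> \<le> \<kappa>' \<Longrightarrow> entropy_dual q p \<kappa> \<le> entropy_dual q p \<kappa>'"
  unfolding entropy_dual_def entropy_admissible_def by (intro SUP_subset_mono) (auto intro: order_trans)

text \<open>Under an integral over \<open>n\<close> the supremum has to be reached along an
  increasing sequence, so that monotone convergence applies. With \<open>0 \<le> \<kappa>\<close>
  the zero function is admissible, so there is a sequence at all.\<close>

lemma entropy_dual_incseq:
  assumes "0 \<le> \<kappa>"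
  shows "\<exists>G. (\<forall>i. G i \<in> entropy_admissible q p \<kappa>) \<and> incseq (\<lambda>i. ennreal (measure_pmf.expectation q (G i)))
       \<and> entropy_dual q p \<kappa> = (SUP i::nat. ennreal (measure_pmf.expectation q (G i)))"
proof -
  let ?e = "\<lambda>G. ennreal (measure_pmf.expectation q G)"
  have "(\<lambda>_. 0) \<in> entropy_admissible q p \<kappa>" using assms by (auto simp: entropy_admissible_def)
  hence "?e ` entropy_admissible q p \<kappa> \<noteq> {}" by blast
  from ennreal_Sup_countable_SUP[OF this] obtain f :: "nat \<Rightarrow> ennreal" where
    f: "incseq f" "range f \<subseteq> ?e ` entropy_admissible q p \<kappa>" "Sup (?e ` entropy_admissible q p \<kappa>) = (SUP i. f i)" by blast
  have "\<forall>i. \<exists>G. G \<in> entropy_admissible q p \<kappa> \<and> f i = ?e G" using f(2) by blast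
  from choice[OF this] obtain G where G: "\<And>i. G i \<in> entropy_admissible q p \<kappa> \<and> f i = ?e (G i)" by blast
  have "f = (\<lambda>i. ?e (G i))" using G by (simp add: fun_eq_iff)
  thus ?thesis using f(1,3) G unfolding entropy_dual_def by (intro exI[of _ G]) simp
qed

text \<open>The half of the chain rule that the induction needs. Since \<open>f\<close> reads
  \<open>n\<close> off the configuration, a test function for \<open>n\<close> and one for each
  conditional law combine into the single test function \<open>g (f x) + G (f x) x\<close>, whose
  Laplace transform is controlled by the two constraints in turn.\<close>

lemma entropy_dual_superadditive:
  fixes q p :: "nat pmf" and Q P :: "nat \<Rightarrow> 'a pmf" and f :: "'a \<Rightarrow> nat"
  assumes fQ: "\<And>n x. n \<in> set_pmf q \<Longrightarrow> x \<in> set_pmf (Q n) \<Longrightarrow> f x = n"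
    and fP: "\<And>n x. n \<in> set_pmf p \<Longrightarrow> x \<in> set_pmf (P n) \<Longrightarrow> f x = n"
    and \<kappa>: "0 \<le> \<kappa>1" "0 \<le> \<kappa>2"
  shows "entropy_dual q p \<kappa>1 + (\<integral>\<^sup>+n. entropy_dual (Q n) (P n) \<kappa>2 \<partial>measure_pmf q)
       \<le> entropy_dual (bind_pmf q Q) (bind_pmf p P) (\<kappa>1 + \<kappa>2)"
proof -
  obtain g where g: "\<And>i. g i \<in> entropy_admissible q p \<kappa>1"
      "incseq (\<lambda>i. ennreal (measure_pmf.expectation q (g i)))"
      "entropy_dual q p \<kappa>1 = (SUP i::nat. ennreal (measure_pmf.expectation q (g i)))"
    using entropy_dual_incseq[OF \<kappa>(1), of q p] by blast
  have "\<forall>n. \<exists>G. (\<forall>i. G i \<in> entropy_admissible (Q n) (P n) \<kappa>2) \<and> incseq (\<lambda>i. ennreal (measure_pmf.expectation (Q n) (G i)))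
       \<and> entropy_dual (Q n) (P n) \<kappa>2 = (SUP i::nat. ennreal (measure_pmf.expectation (Q n) (G i)))"
    using entropy_dual_incseq[OF \<kappa>(2)] by blast
  from choice[OF this] obtain G where G: "\<And>n i. G n i \<in> entropy_admissible (Q n) (P n) \<kappa>2"
      "\<And>n. incseq (\<lambda>i. ennreal (measure_pmf.expectation (Q n) (G n i)))"
      "\<And>n. entropy_dual (Q n) (P n) \<kappa>2 = (SUP i::nat. ennreal (measure_pmf.expectation (Q n) (G n i)))"
    by blast
  \<comment> \<open>The bounds of the \<open>G n i\<close> need not be uniform in \<open>n\<close>.
    Using them only for \<open>n < i\<close> keeps the combined test function bounded, and the cut
    disappears in the supremum.\<close>
  define v where "v i n = (if n < i then ennreal (measure_pmf.expectation (Q n) (G n i)) else 0)" for i n :: nat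
  have incv: "incseq v"
    using G(2) unfolding incseq_def v_def le_fun_def by auto
  have supv: "entropy_dual (Q n) (P n) \<kappa>2 = (SUP i. v i n)" for n
  proof (rule antisym)
    show "entropy_dual (Q n) (P n) \<kappa>2 \<le> (SUP i. v i n)"
      unfolding G(3)
    proof (rule SUP_least)
      fix i
      \<comment> \<open>The index has to exceed \<open>n\<close> to survive the cut, hence
        \<open>Suc n\<close>.\<close>
      have "ennreal (measure_pmf.expectation (Q n) (G n i)) \<le> v (max i (Suc n)) n"
        using G(2)[of n] by (auto simp: v_def incseq_def)
      also have "\<dots> \<le> (SUP i. v i n)" by (rule SUP_upper) simp
      finally show "ennreal (measure_pmf.expectation (Q n) (G n i)) \<le> (SUP i. v i n)" .
    qed
    show "(SUP i. v i n) \<le> entropy_dual (Q n) (P n) \<kappa>2"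
      unfolding G(3) by (rule SUP_least) (auto simp: v_def intro: SUP_upper)
  qed
  have "(\<integral>\<^sup>+n. entropy_dual (Q n) (P n) \<kappa>2 \<partial>measure_pmf q) = (SUP i. \<integral>\<^sup>+n. v i n \<partial>measure_pmf q)"
    unfolding supv by (rule nn_integral_monotone_convergence_SUP[OF incv]) simp
  hence "entropy_dual q p \<kappa>1 + (\<integral>\<^sup>+n. entropy_dual (Q n) (P n) \<kappa>2 \<partial>measure_pmf q)
     = (SUP i. ennreal (measure_pmf.expectation q (g i)) + (\<integral>\<^sup>+n. v i n \<partial>measure_pmf q))"
    using g(2) incv unfolding g(3)
    by (subst ennreal_SUP_add) (auto simp: incseq_def le_fun_def intro!: nn_integral_mono)
  also have "\<dots> \<le> entropy_dual (bind_pmf q Q) (bind_pmf p P) (\<kappa>1 + \<kappa>2)"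
  proof (rule SUP_least)
    fix i :: nat
    define H where "H n x = (if n < i then G n i x else 0)" for n x
    define F where "F x = g i (f x) + H (f x) x" for x
    obtain Bg where Bg: "\<And>x. \<bar>g i x\<bar> \<le> Bg" using entropy_admissibleD(1)[OF g(1)] by blast
    have "\<forall>n. \<exists>B. \<forall>x. \<bar>G n i x\<bar> \<le> B" using entropy_admissibleD(1)[OF G(1)] by blast
    then obtain BG where BG: "\<And>n x. \<bar>G n i x\<bar> \<le> BG n" by metis
    have BG0: "0 \<le> BG n" for n using BG[of n undefined] by linarith
    define BH where "BH = (\<Sum>n<i. BG n)"
    have "BH \<ge> 0" unfolding BH_def by (intro sum_nonneg BG0)
    have BH: "\<bar>H n x\<bar> \<le> BH" for n x
    proof (cases "n < i")
      case True
      have "\<bar>H n x\<bar> \<le> BG n" using BG True by (simp add: H_def)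
      also have "\<dots> \<le> BH" unfolding BH_def by (rule member_le_sum) (use True BG0 in auto)
      finally show ?thesis .
    qed (use \<open>BH \<ge> 0\<close> in \<open>simp add: H_def\<close>)
    have BF: "\<bar>F x\<bar> \<le> Bg + BH" for x
      using Bg[of "f x"] BH[of "f x" x] by (simp add: F_def)
    have BeF: "\<bar>exp (F x)\<bar> \<le> exp (Bg + BH)" for x using BF[of x] by auto
    \<comment> \<open>Beyond the cut \<open>H\<close> is zero and the expectation is 1, which
      \<open>0 \<le> \<kappa>2\<close> allows.\<close>
    have E_eH: "measure_pmf.expectation (P n) (\<lambda>x. exp (H n x)) \<le> exp \<kappa>2" for n
      using entropy_admissibleD(2)[OF G(1), of n i] \<kappa> by (cases "n < i") (auto simp: H_def)
    have "measure_pmf.expectation (bind_pmf p P) (\<lambda>x. exp (F x))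
        = measure_pmf.expectation p (\<lambda>n. measure_pmf.expectation (P n) (\<lambda>x. exp (F x)))"
      by (rule expectation_bind_pmf[OF BeF])
    also have "\<dots> = measure_pmf.expectation p (\<lambda>n. exp (g i n) * measure_pmf.expectation (P n) (\<lambda>x. exp (H n x)))"
    proof (intro integral_cong_AE)
      show "AE n in measure_pmf p. measure_pmf.expectation (P n) (\<lambda>x. exp (F x))
         = exp (g i n) * measure_pmf.expectation (P n) (\<lambda>x. exp (H n x))"
        unfolding AE_measure_pmf_iff
      proof
        fix n assume "n \<in> set_pmf p"
        have "measure_pmf.expectation (P n) (\<lambda>x. exp (F x))
            = measure_pmf.expectation (P n) (\<lambda>x. exp (g i n) * exp (H n x))"
          by (intro integral_cong_AE)
             (use fP[OF \<open>n \<in> set_pmf p\<close>] in \<open>auto simp: AE_measure_pmf_iff F_def exp_add\<close>)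
        thus "measure_pmf.expectation (P n) (\<lambda>x. exp (F x))
         = exp (g i n) * measure_pmf.expectation (P n) (\<lambda>x. exp (H n x))" by simp
      qed
    qed auto
    also have "\<dots> \<le> measure_pmf.expectation p (\<lambda>n. exp (g i n) * exp \<kappa>2)"
    proof (intro integral_mono mult_left_mono E_eH)
      have "\<bar>exp (g i n) * exp \<kappa>2\<bar> \<le> exp Bg * exp \<kappa>2" for n
        using Bg[of n] by (simp add: abs_le_D1)
      thus "integrable (measure_pmf p) (\<lambda>n. exp (g i n) * exp \<kappa>2)"
        by (rule integrable_measure_pmf_bounded)
      have "\<bar>exp (g i n) * measure_pmf.expectation (P n) (\<lambda>x. exp (H n x))\<bar> \<le> exp Bg * exp \<kappa>2" for n
      proof -
        have E0: "0 \<le> measure_pmf.expectation (P n) (\<lambda>x. exp (H n x))"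
          by (rule Bochner_Integration.integral_nonneg) simp
        have "exp (g i n) * measure_pmf.expectation (P n) (\<lambda>x. exp (H n x)) \<le> exp Bg * exp \<kappa>2"
          by (rule mult_mono[OF _ E_eH _ E0]) (use Bg[of n] in simp_all)
        thus ?thesis using E0 by (simp add: abs_mult)
      qed
      thus "integrable (measure_pmf p) (\<lambda>n. exp (g i n) * measure_pmf.expectation (P n) (\<lambda>x. exp (H n x)))"
        by (rule integrable_measure_pmf_bounded)
    qed auto
    also have "\<dots> \<le> exp (\<kappa>1 + \<kappa>2)"
      using entropy_admissibleD(2)[OF g(1), of i] by (simp add: exp_add)
    finally have EP: "measure_pmf.expectation (bind_pmf p P) (\<lambda>x. exp (F x)) \<le> exp (\<kappa>1 + \<kappa>2)" .
    have int_EH: "integrable (measure_pmf q) (\<lambda>n. measure_pmf.expectation (Q n) (H n))"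
      by (rule integrable_measure_pmf_bounded[where B = BH]) (rule abs_expectation_le, rule BH)
    have EH0: "0 \<le> measure_pmf.expectation (Q n) (H n)" for n
      using entropy_admissibleD(3)[OF G(1), of n i] by (cases "n < i") (auto simp: H_def[abs_def])
    have "measure_pmf.expectation (bind_pmf q Q) F
        = measure_pmf.expectation q (\<lambda>n. measure_pmf.expectation (Q n) F)"
      by (rule expectation_bind_pmf[OF BF])
    also have "\<dots> = measure_pmf.expectation q (\<lambda>n. g i n + measure_pmf.expectation (Q n) (H n))"
    proof (intro integral_cong_AE)
      show "AE n in measure_pmf q. measure_pmf.expectation (Q n) F
         = g i n + measure_pmf.expectation (Q n) (H n)"
        unfolding AE_measure_pmf_iff
      proof
        fix n assume "n \<in> set_pmf q"
        have "measure_pmf.expectation (Q n) F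
            = measure_pmf.expectation (Q n) (\<lambda>x. g i n + H n x)"
          by (intro integral_cong_AE)
             (use fQ[OF \<open>n \<in> set_pmf q\<close>] in \<open>auto simp: AE_measure_pmf_iff F_def\<close>)
        thus "measure_pmf.expectation (Q n) F = g i n + measure_pmf.expectation (Q n) (H n)"
          by (subst (asm) Bochner_Integration.integral_add)
             (auto intro: integrable_measure_pmf_bounded[OF BH])
      qed
    qed auto
    also have "\<dots> = measure_pmf.expectation q (g i) + measure_pmf.expectation q (\<lambda>n. measure_pmf.expectation (Q n) (H n))"
      by (rule Bochner_Integration.integral_add) (auto intro: int_EH integrable_measure_pmf_bounded[OF Bg])
    finally have EQ: "measure_pmf.expectation (bind_pmf q Q) F
      = measure_pmf.expectation q (g i) + measure_pmf.expectation q (\<lambda>n. measure_pmf.expectation (Q n) (H n))" .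
    have "(\<integral>\<^sup>+n. v i n \<partial>measure_pmf q) = (\<integral>\<^sup>+n. ennreal (measure_pmf.expectation (Q n) (H n)) \<partial>measure_pmf q)"
      by (intro nn_integral_cong) (auto simp: v_def H_def[abs_def])
    also have "\<dots> = ennreal (measure_pmf.expectation q (\<lambda>n. measure_pmf.expectation (Q n) (H n)))"
      by (rule nn_integral_eq_integral[OF int_EH]) (use EH0 in auto)
    finally have "ennreal (measure_pmf.expectation q (g i)) + (\<integral>\<^sup>+n. v i n \<partial>measure_pmf q)
       = ennreal (measure_pmf.expectation (bind_pmf q Q) F)"
      unfolding EQ using entropy_admissibleD(3)[OF g(1), of i] EH0 by (simp add: ennreal_plus)
    also have "\<dots> \<le> entropy_dual (bind_pmf q Q) (bind_pmf p P) (\<kappa>1 + \<kappa>2)"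
      by (rule le_entropy_dual[OF BF EP])
    finally show "ennreal (measure_pmf.expectation q (g i)) + (\<integral>\<^sup>+n. v i n \<partial>measure_pmf q)
       \<le> entropy_dual (bind_pmf q Q) (bind_pmf p P) (\<kappa>1 + \<kappa>2)" .
  qed
  finally show ?thesis .
qed

lemma has_bochner_integral_pmf_nat:
  fixes f :: "nat \<Rightarrow> real"
  assumes f: "\<And>k. 0 \<le> f k" and s: "(\<lambda>k. pmf p k * f k) sums s"
  shows "has_bochner_integral (measure_pmf p) f s"
proof (rule has_bochner_integral_nn_integral)
  have "(\<integral>\<^sup>+k. ennreal (f k) \<partial>measure_pmf p) = (\<Sum>k. ennreal (pmf p k * f k))"
    by (simp add: nn_integral_measure_pmf nn_integral_count_space_nat ennreal_mult f)
  also have "\<dots> = ennreal s"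
    by (subst suminf_ennreal2[OF _ sums_summable[OF s]]) (simp_all add: f sums_unique[OF s])
  finally show "(\<integral>\<^sup>+k. ennreal (f k) \<partial>measure_pmf p) = ennreal s" .
  show "0 \<le> s" using s f sums_le[of "\<lambda>_. 0" "\<lambda>k. pmf p k * f k" 0 s] by simp
qed (use f in auto)

section \<open>Optimal transport on the natural numbers\<close>

abbreviation nat_dist :: "nat \<Rightarrow> nat \<Rightarrow> real" where
  "nat_dist x y \<equiv> \<bar>real x - real y\<bar>"

lemma pmf_nat_eqI_cdf:
  fixes p q :: "nat pmf"
  assumes "\<And>j. measure p {..j} = measure q {..j}"
  shows "p = q"
proof (rule pmf_eqI)
  fix n
  have *: "pmf r n = measure r {..n} - (if n = 0 then 0 else measure r {..n - 1})" for r :: "nat pmf"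
  proof (cases n)
    case 0
    thus ?thesis by (simp add: measure_pmf_single atMost_0)
  next
    case (Suc m)
    have "{..n} = {..m} \<union> {n}" using Suc by auto
    hence "measure r {..n} = measure r {..m} + measure r {n}"
      using measure_pmf.finite_measure_Union[of "{..m}" r "{n}"] Suc by (simp del: Un_insert_right)
    thus ?thesis using Suc by (simp add: measure_pmf_single)
  qed
  show "pmf p n = pmf q n" by (simp add: *[of p] *[of q] assms)
qed

section \<open>Quantile functions and the comonotone coupling\<close>

definition quantile :: "nat pmf \<Rightarrow> real \<Rightarrow> nat" where
  "quantile q u = (LEAST n. u \<le> measure q {..n})"

text \<open>The distribution function tends to 1, so for \<open>u < 1\<close> the
  \<open>LEAST\<close> is attained. At \<open>u = 1\<close> it need not be, which is why the uniform
  law is taken on the open interval.\<close>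

lemma quantile_le_iff:
  assumes "u < 1"
  shows "quantile q u \<le> j \<longleftrightarrow> u \<le> measure q {..j}"
proof -
  have "(\<lambda>n. measure q {..n}) \<longlonglongrightarrow> measure q (\<Union>n. {..n})"
    by (rule measure_pmf.finite_Lim_measure_incseq) (auto simp: incseq_def)
  moreover have "(\<Union>n::nat. {..n}) = UNIV" by auto
  ultimately have "(\<lambda>n. measure q {..n}) \<longlonglongrightarrow> 1" by simp
  from order_tendstoD(1)[OF this assms] obtain n where "u \<le> measure q {..n}"
    by (auto simp: eventually_sequentially intro: less_imp_le)
  hence *: "u \<le> measure q {..quantile q u}" unfolding quantile_def by (rule LeastI)
  show ?thesis
  proof
    assume "quantile q u \<le> j"
    hence "measure q {..quantile q u} \<le> measure q {..j}"
      by (intro measure_pmf.finite_measure_mono) auto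
    thus "u \<le> measure q {..j}" using * by simp
  qed (simp add: quantile_def Least_le)
qed

definition unif01 :: "real measure" where
  "unif01 = uniform_measure lborel {0<..<1}"

lemma prob_space_unif01: "prob_space unif01"
  unfolding unif01_def by (rule prob_space_uniform_measure) auto

lemma emeasure_unif01: "A \<in> sets borel \<Longrightarrow> emeasure unif01 A = emeasure lborel ({0<..<1} \<inter> A)"
  unfolding unif01_def by (simp add: emeasure_uniform_measure divide_ennreal_def)

lemma measurable_quantile [measurable]: "quantile q \<in> unif01 \<rightarrow>\<^sub>M count_space UNIV"
  unfolding quantile_def unif01_def by measurable

lemma unif01_quantile_le: "emeasure unif01 {u. quantile q u \<le> j} = measure q {..j}"
proof -
  have m: "quantile q \<in> borel \<rightarrow>\<^sub>M count_space UNIV" unfolding quantile_def by measurable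
  have "{u. quantile q u \<le> j} \<in> sets borel"
    using measurable_sets[OF m, of "{..j}"] by (simp add: vimage_def)
  hence "emeasure unif01 {u. quantile q u \<le> j} = emeasure lborel ({0<..<1} \<inter> {u. quantile q u \<le> j})"
    by (rule emeasure_unif01)
  also have "{0<..<1} \<inter> {u. quantile q u \<le> j} = {0<..<1} \<inter> {u. u \<le> measure q {..j}}"
    using quantile_le_iff by auto
  also have "emeasure lborel \<dots> = ennreal (measure q {..j})"
  proof (cases "measure q {..j} = 1")
    case True
    hence "{0<..<1} \<inter> {u. u \<le> measure q {..j}} = {0<..<1}" by auto
    thus ?thesis using True by simp
  next
    case False
    hence "measure q {..j} < 1" using measure_pmf.prob_le_1[of q "{..j}"] by linarith
    hence "{0<..<1} \<inter> {u. u \<le> measure q {..j}} = {0<..measure q {..j}}" by auto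
    thus ?thesis by simp
  qed
  finally show ?thesis .
qed

text \<open>Feeding one uniform variable into both quantile functions couples \<open>q\<close> and
  \<open>p\<close>. The distance of two numbers counts the levels \<open>j\<close> that separate
  them, and the two quantiles are separated by \<open>j\<close> only when \<open>u\<close> falls
  between the values of the two distribution functions at \<open>j\<close>.\<close>

lemma wasserstein1_nat_le:
  "wasserstein1 nat_dist q p \<le> (\<Sum>j. ennreal \<bar>measure q {..j} - measure p {..j}\<bar>)"
proof -
  interpret U: prob_space unif01 by (rule prob_space_unif01)
  let ?T = "\<lambda>u. (quantile q u, quantile p u)"
  have mT [measurable]: "?T \<in> unif01 \<rightarrow>\<^sub>M count_space UNIV"
  proof -
    have "?T \<in> unif01 \<rightarrow>\<^sub>M count_space UNIV \<Otimes>\<^sub>M count_space UNIV" by measurable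
    thus ?thesis by (simp add: pair_measure_countable)
  qed
  let ?D = "distr unif01 (count_space UNIV) ?T"
  interpret D: prob_space ?D by (rule U.prob_space_distr[OF mT])
  \<comment> \<open>The image law lives on a countable set, so it is carried by its atoms and is a
    genuine pmf.\<close>
  have ae: "AE x in ?D. measure ?D {x} \<noteq> 0"
    by (subst D.AE_support_countable) (auto intro: exI[of _ UNIV])
  define \<pi> where "\<pi> = Abs_pmf ?D"
  have \<pi>: "measure_pmf \<pi> = ?D"
    unfolding \<pi>_def by (rule Abs_pmf_inverse) (use ae D.prob_space_axioms in simp)
  have "map_pmf fst \<pi> = q"
  proof (rule pmf_nat_eqI_cdf)
    fix j
    have "emeasure (measure_pmf (map_pmf fst \<pi>)) {..j} = emeasure unif01 (?T -` (fst -` {..j}) \<inter> space unif01)"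
      by (simp add: \<pi> emeasure_distr)
    also have "?T -` (fst -` {..j}) \<inter> space unif01 = {u. quantile q u \<le> j}"
      by (auto simp: unif01_def)
    finally show "measure (map_pmf fst \<pi>) {..j} = measure q {..j}"
      by (simp add: unif01_quantile_le measure_pmf.emeasure_eq_measure)
  qed
  moreover have "map_pmf snd \<pi> = p"
  proof (rule pmf_nat_eqI_cdf)
    fix j
    have "emeasure (measure_pmf (map_pmf snd \<pi>)) {..j} = emeasure unif01 (?T -` (snd -` {..j}) \<inter> space unif01)"
      by (simp add: \<pi> emeasure_distr)
    also have "?T -` (snd -` {..j}) \<inter> space unif01 = {u. quantile p u \<le> j}"
      by (auto simp: unif01_def)
    finally show "measure (map_pmf snd \<pi>) {..j} = measure p {..j}"
      by (simp add: unif01_quantile_le measure_pmf.emeasure_eq_measure)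
  qed
  ultimately have "wasserstein1 nat_dist q p \<le> transport_cost nat_dist \<pi>"
    by (intro wasserstein1_le) (simp add: couplings_def)
  also have "\<dots> = (\<integral>\<^sup>+u. ennreal (nat_dist (quantile q u) (quantile p u)) \<partial>unif01)"
    by (simp add: \<pi> nn_integral_distr)
  also have "\<dots> = (\<integral>\<^sup>+u. (\<Sum>j. indicator {u. (quantile q u \<le> j) \<noteq> (quantile p u \<le> j)} u) \<partial>unif01)"
  proof (rule nn_integral_cong)
    fix u
    have "ennreal (nat_dist m n) = (\<Sum>j. indicator {j. (m \<le> j) \<noteq> (n \<le> j)} j)" for m n :: nat
    proof -
      have "{j. (m \<le> j) \<noteq> (n \<le> j)} = {min m n..<max m n}" by auto
      hence "(\<Sum>j. indicator {j. (m \<le> j) \<noteq> (n \<le> j)} j :: ennreal) = (\<Sum>j\<in>{min m n..<max m n}. 1)"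
        by (subst suminf_finite[of "{min m n..<max m n}"]) auto
      also have "\<dots> = ennreal (nat_dist m n)"
        by (auto simp: ennreal_of_nat_eq_real_of_nat of_nat_diff min_def max_def)
      finally show ?thesis by simp
    qed
    from this[of "quantile q u" "quantile p u"]
    show "ennreal (nat_dist (quantile q u) (quantile p u))
        = (\<Sum>j. indicator {u. (quantile q u \<le> j) \<noteq> (quantile p u \<le> j)} u)"
      by (simp add: indicator_def)
  qed
  also have "\<dots> = (\<Sum>j. emeasure unif01 {u. (quantile q u \<le> j) \<noteq> (quantile p u \<le> j)})"
  proof (subst nn_integral_suminf)
    have M: "{u. (quantile q u \<le> j) \<noteq> (quantile p u \<le> j)} \<in> sets unif01" for j
    proof -
      have "{u. (quantile q u \<le> j) \<noteq> (quantile p u \<le> j)} = ?T -` {(a, b). (a \<le> j) \<noteq> (b \<le> j)} \<inter> space unif01"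
        by (auto simp: unif01_def)
      also have "\<dots> \<in> sets unif01" by (rule measurable_sets[OF mT]) simp
      finally show ?thesis .
    qed
    thus "indicator {u. (quantile q u \<le> j) \<noteq> (quantile p u \<le> j)} \<in> borel_measurable unif01" for j by simp
    show "(\<Sum>j. \<integral>\<^sup>+u. indicator {u. (quantile q u \<le> j) \<noteq> (quantile p u \<le> j)} u \<partial>unif01)
      = (\<Sum>j. emeasure unif01 {u. (quantile q u \<le> j) \<noteq> (quantile p u \<le> j)})"
      by (subst nn_integral_indicator[OF M]) simp
  qed
  also have "\<dots> \<le> (\<Sum>j. ennreal \<bar>measure q {..j} - measure p {..j}\<bar>)"
  proof (intro suminf_le)
    fix j
    let ?a = "measure q {..j}" and ?b = "measure p {..j}"
    have mq: "quantile r \<in> borel \<rightarrow>\<^sub>M count_space UNIV" for r unfolding quantile_def by measurable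
    have "{u. (quantile q u \<le> j) \<noteq> (quantile p u \<le> j)} \<in> sets borel"
    proof -
      have "{u. quantile r u \<le> j} \<in> sets borel" for r
        using measurable_sets[OF mq, of "{..j}"] by (simp add: vimage_def)
      hence "({u. quantile q u \<le> j} - {u. quantile p u \<le> j}) \<union> ({u. quantile p u \<le> j} - {u. quantile q u \<le> j}) \<in> sets borel"
        by (intro sets.Un sets.Diff)
      also have "({u. quantile q u \<le> j} - {u. quantile p u \<le> j}) \<union> ({u. quantile p u \<le> j} - {u. quantile q u \<le> j})
        = {u. (quantile q u \<le> j) \<noteq> (quantile p u \<le> j)}" by blast
      finally show ?thesis .
    qed
    hence "emeasure unif01 {u. (quantile q u \<le> j) \<noteq> (quantile p u \<le> j)}
       = emeasure lborel ({0<..<1} \<inter> {u. (quantile q u \<le> j) \<noteq> (quantile p u \<le> j)})"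
      by (rule emeasure_unif01)
    also have "\<dots> \<le> emeasure lborel {min ?a ?b..max ?a ?b}"
      by (rule emeasure_mono) (auto simp: quantile_le_iff)
    also have "\<dots> = ennreal \<bar>?a - ?b\<bar>" by (simp add: min_def max_def abs_if)
    finally show "emeasure unif01 {u. (quantile q u \<le> j) \<noteq> (quantile p u \<le> j)} \<le> ennreal \<bar>?a - ?b\<bar>" .
  qed auto
  finally show ?thesis .
qed

text \<open>The Bobkov-Goetze dual of a transport-entropy inequality at one fixed slope
  \<open>l\<close>. On the naturals it suffices to control unit steps, and restricting to bounded
  \<open>g\<close> makes every expectation meaningful.\<close>

definition lipschitz_mgf :: "real \<Rightarrow> real \<Rightarrow> nat pmf \<Rightarrow> bool" where
  "lipschitz_mgf l \<kappa> p \<longleftrightarrow> (\<forall>g B. (\<forall>n. \<bar>g n\<bar> \<le> B) \<longrightarrow> (\<forall>n. \<bar>g (Suc n) - g n\<bar> \<le> 1) \<longrightarrow>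
     measure_pmf.expectation p (\<lambda>n. exp (l * g n)) \<le> exp (l * measure_pmf.expectation p g + \<kappa>))"

text \<open>The cost is bounded by the sum of the gaps between the distribution functions, and a
  Kantorovich potential for that sum is explicit: climb by the sign of the gap at each level. Cut
  off at \<open>m\<close> it is bounded; centred under \<open>p\<close> and multiplied by
  \<open>l\<close> it becomes an admissible test function.\<close>

lemma wasserstein1_nat_le_entropy_dual:
  assumes M: "lipschitz_mgf l \<kappa> p" and l: "0 \<le> l"
  shows "ennreal l * wasserstein1 nat_dist q p \<le> entropy_dual q p \<kappa>"
proof -
  let ?t = "\<lambda>j. \<bar>measure q {..j} - measure p {..j}\<bar>"
  have part: "ennreal l * (\<Sum>j<m. ennreal (?t j)) \<le> entropy_dual q p \<kappa>" for m
  proof -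
    \<comment> \<open>The sign is chosen so that each level contributes its absolute gap to the
      difference of the expectations of \<open>g\<close> under \<open>q\<close> and
      \<open>p\<close>.\<close>
    define s :: "nat \<Rightarrow> real" where "s j = (if measure q {..j} \<le> measure p {..j} then 1 else -1)" for j
    define g where "g n = (\<Sum>j<m. s j * indicator {j<..} n)" for n :: nat
    have s1: "\<bar>s j\<bar> = 1" for j by (simp add: s_def)
    have Bg: "\<bar>g n\<bar> \<le> real m" for n
    proof -
      have "\<bar>g n\<bar> \<le> (\<Sum>j<m. \<bar>s j * indicator {j<..} n\<bar>)" unfolding g_def by (rule sum_abs)
      also have "\<dots> \<le> (\<Sum>j<m. 1)" by (intro sum_mono) (auto simp: abs_mult s1 indicator_def)
      finally show ?thesis by simp
    qed
    have Lg: "\<bar>g (Suc n) - g n\<bar> \<le> 1" for n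
    proof -
      have "g (Suc n) - g n = (\<Sum>j<m. if j = n then s j else 0)"
        unfolding g_def sum_subtractf[symmetric]
        by (intro sum.cong) (auto simp: indicator_def)
      thus ?thesis by (simp add: sum.delta s1)
    qed
    have Eg: "measure_pmf.expectation r g = (\<Sum>j<m. s j * (1 - measure r {..j}))" for r :: "nat pmf"
    proof -
      have "measure r {j<..} = 1 - measure r {..j}" for j
        using measure_pmf.prob_compl[of "{..j}" r] by (simp add: Compl_eq_Diff_UNIV[symmetric] Compl_atMost)
      moreover have "integrable (measure_pmf r) (indicat_real {j<..})" for j :: nat
        by (rule integrable_measure_pmf_bounded[where B = 1]) (auto simp: indicator_def)
      ultimately show ?thesis unfolding g_def by (subst Bochner_Integration.integral_sum) auto
    qed
    let ?E = "measure_pmf.expectation p g"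
    define G where "G n = l * (g n - ?E)" for n
    have E1: "measure_pmf.expectation p (\<lambda>n. exp (l * g n)) \<le> exp (l * ?E + \<kappa>)"
      using M Bg Lg unfolding lipschitz_mgf_def by blast
    have "measure_pmf.expectation p (\<lambda>n. exp (G n)) = exp (- l * ?E) * measure_pmf.expectation p (\<lambda>n. exp (l * g n))"
      by (simp add: G_def algebra_simps exp_add exp_diff exp_minus field_simps)
    also have "\<dots> \<le> exp (- l * ?E) * exp (l * ?E + \<kappa>)"
      by (intro mult_left_mono E1) auto
    also have "\<dots> = exp \<kappa>" by (simp flip: exp_add)
    finally have EG: "measure_pmf.expectation p (\<lambda>n. exp (G n)) \<le> exp \<kappa>" .
    have BG: "\<bar>G n\<bar> \<le> l * (2 * real m)" for n
    proof -
      have "\<bar>?E\<bar> \<le> real m" by (rule abs_expectation_le) (rule Bg)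
      hence "\<bar>g n - ?E\<bar> \<le> 2 * real m" using Bg[of n] by linarith
      thus ?thesis using l by (simp add: G_def abs_mult mult_left_mono)
    qed
    have "measure_pmf.expectation q G = l * (measure_pmf.expectation q g - ?E)"
      unfolding G_def using integrable_measure_pmf_bounded[of g "real m" q] Bg by simp
    also have "measure_pmf.expectation q g - ?E = (\<Sum>j<m. s j * (measure p {..j} - measure q {..j}))"
      unfolding Eg sum_subtractf[symmetric] by (intro sum.cong) (auto simp: algebra_simps)
    also have "\<dots> = (\<Sum>j<m. ?t j)" by (intro sum.cong) (auto simp: s_def)
    finally have "ennreal (l * (\<Sum>j<m. ?t j)) \<le> entropy_dual q p \<kappa>"
      using le_entropy_dual[of G, OF BG EG, of q] by simp
    thus ?thesis using l by (simp add: ennreal_mult sum_nonneg)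
  qed
  have "ennreal l * wasserstein1 nat_dist q p \<le> ennreal l * (\<Sum>j. ennreal (?t j))"
    by (intro mult_left_mono wasserstein1_nat_le) simp
  also have "\<dots> = (SUP m. ennreal l * (\<Sum>j<m. ennreal (?t j)))"
    by (simp add: suminf_eq_SUP SUP_mult_left_ennreal)
  also have "\<dots> \<le> entropy_dual q p \<kappa>" by (rule SUP_least) (rule part)
  finally show ?thesis .
qed

section \<open>Poisson distributions\<close>

text \<open>Intensity 0 does occur: an occupied neighbour with \<open>a k j = 0\<close> damps the
  intensity at \<open>k\<close> to nothing. The point mass has the Poisson weights at
  \<open>t = 0\<close>, by \<open>0 ^ 0 = 1\<close>.\<close>

definition poisson_law :: "real \<Rightarrow> nat pmf" where
  "poisson_law t = (if t = 0 then return_pmf 0 else poisson_pmf t)"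

lemma pmf_poisson_law: "0 \<le> t \<Longrightarrow> pmf (poisson_law t) k = exp (- t) * t ^ k / fact k"
  by (cases k) (auto simp: poisson_law_def)

lemma exp_power_series: "(\<lambda>k. x ^ k / fact k) sums exp (x::real)"
  using exp_converges[of x] by (simp add: divide_inverse mult.commute)

lemma poisson_law_mgf:
  assumes "0 \<le> t"
  shows "has_bochner_integral (measure_pmf (poisson_law t)) (\<lambda>n. exp (l * real n)) (exp (t * (exp l - 1)))"
proof (rule has_bochner_integral_pmf_nat)
  have "(\<lambda>k. exp (- t) * ((t * exp l) ^ k / fact k)) sums (exp (- t) * exp (t * exp l))"
    by (intro sums_mult exp_power_series)
  moreover have "exp (- t) * exp (t * exp l) = exp (t * (exp l - 1))"
    by (simp add: algebra_simps flip: exp_add)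
  moreover have "exp (- t) * ((t * exp l) ^ k / fact k) = pmf (poisson_law t) k * exp (l * real k)" for k
    using assms by (simp add: pmf_poisson_law power_mult_distrib exp_of_nat_mult[symmetric] mult.commute)
  ultimately show "(\<lambda>k. pmf (poisson_law t) k * exp (l * real k)) sums exp (t * (exp l - 1))" by simp
qed simp

lemma poisson_law_mean:
  assumes "0 \<le> t"
  shows "has_bochner_integral (measure_pmf (poisson_law t)) real t"
proof (rule has_bochner_integral_pmf_nat)
  have "(\<lambda>k. exp (- t) * t * (t ^ k / fact k)) sums (exp (- t) * t * exp t)"
    by (intro sums_mult exp_power_series)
  moreover have "exp (- t) * t * exp t = t"
    by (simp add: exp_minus field_simps)
  ultimately have "(\<lambda>k. exp (- t) * t * (t ^ k / fact k)) sums t" by (simp only:)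
  moreover have "exp (- t) * t * (t ^ k / fact k) = pmf (poisson_law t) (Suc k) * real (Suc k)" for k
  proof -
    have "pmf (poisson_law t) (Suc k) * real (Suc k) = exp (- t) * t * t ^ k * (real (Suc k) / fact (Suc k))"
      using assms by (simp add: pmf_poisson_law)
    also have "real (Suc k) / fact (Suc k) = 1 / fact k" by (subst fact_Suc) simp
    finally show ?thesis by simp
  qed
  ultimately have "(\<lambda>k. pmf (poisson_law t) (Suc k) * real (Suc k)) sums t" by simp
  thus "(\<lambda>k. pmf (poisson_law t) k * real k) sums t"
    using sums_Suc[of "\<lambda>k. pmf (poisson_law t) k * real k"] by simp
qed simp

lemma nn_integral_poisson_law_mean: "0 \<le> t \<Longrightarrow> (\<integral>\<^sup>+n. ennreal (real n) \<partial>measure_pmf (poisson_law t)) = ennreal t"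
  using poisson_law_mean[of t] by (subst nn_integral_eq_integral) (auto simp: has_bochner_integral_iff)

definition nat_convolution :: "nat pmf \<Rightarrow> nat pmf \<Rightarrow> nat pmf" where
  "nat_convolution p q = bind_pmf p (\<lambda>x. map_pmf (\<lambda>y. x + y) q)"

lemma nat_convolution_poisson_law:
  assumes "0 \<le> s" "0 \<le> t"
  shows "nat_convolution (poisson_law s) (poisson_law t) = poisson_law (s + t)"
proof (rule pmf_eqI)
  fix n
  have m: "pmf (map_pmf (\<lambda>y. x + y) (poisson_law t)) n = (if x \<le> n then pmf (poisson_law t) (n - x) else 0)" for x
  proof (cases "x \<le> n")
    case True
    have "pmf (map_pmf (\<lambda>y. x + y) (poisson_law t)) (x + (n - x)) = pmf (poisson_law t) (n - x)"
      by (rule pmf_map_inj') (simp add: inj_on_def)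
    thus ?thesis using True by simp
  next
    case False
    hence "(\<lambda>y. x + y) -` {n} = {}" by auto
    thus ?thesis using False by (simp add: pmf_map)
  qed
  have "pmf (nat_convolution (poisson_law s) (poisson_law t)) n = measure_pmf.expectation (poisson_law s) (\<lambda>x. if x \<le> n then pmf (poisson_law t) (n - x) else 0)"
    unfolding nat_convolution_def pmf_bind m ..
  also have "\<dots> = (\<Sum>x\<le>n. pmf (poisson_law s) x * pmf (poisson_law t) (n - x))"
    by (subst integral_measure_pmf_real[of "{..n}"]) (auto split: if_splits simp: mult.commute intro!: sum.cong)
  also have "\<dots> = (\<Sum>x\<le>n. exp (- (s + t)) / fact n * (of_nat (n choose x) * s ^ x * t ^ (n - x)))"
    using assms by (intro sum.cong) (auto simp: pmf_poisson_law binomial_fact exp_add[symmetric] field_simps)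
  also have "\<dots> = exp (- (s + t)) / fact n * (s + t) ^ n"
    by (simp add: binomial_ring sum_distrib_left)
  also have "\<dots> = pmf (poisson_law (s + t)) n" using assms by (simp add: pmf_poisson_law)
  finally show "pmf (nat_convolution (poisson_law s) (poisson_law t)) n = pmf (poisson_law (s + t)) n" .
qed

text \<open>The larger Poisson variable is the smaller one plus an independent Poisson increment.
  This coupling is monotone, so its cost is the mean of the increment.\<close>

lemma poisson_law_coupling:
  assumes "0 \<le> s" "0 \<le> t"
  shows "\<exists>\<pi>\<in>couplings (poisson_law s) (poisson_law t). transport_cost nat_dist \<pi> \<le> ennreal \<bar>s - t\<bar>"
proof -
  have *: "\<exists>\<pi>\<in>couplings (poisson_law s) (poisson_law t). transport_cost nat_dist \<pi> \<le> ennreal (t - s)" if "0 \<le> s" "s \<le> t" for s t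
  proof
    define \<pi> where "\<pi> = bind_pmf (poisson_law s) (\<lambda>x. map_pmf (\<lambda>y. (x, x + y)) (poisson_law (t - s)))"
    have "map_pmf fst \<pi> = poisson_law s"
      by (simp add: \<pi>_def map_bind_pmf map_pmf_comp bind_return_pmf')
    moreover have "map_pmf snd \<pi> = poisson_law t"
      using nat_convolution_poisson_law[of s "t - s"] that by (simp add: \<pi>_def map_bind_pmf map_pmf_comp nat_convolution_def)
    ultimately show "\<pi> \<in> couplings (poisson_law s) (poisson_law t)" by (simp add: couplings_def)
    have "transport_cost nat_dist \<pi> = (\<integral>\<^sup>+x. (\<integral>\<^sup>+y. ennreal (real y) \<partial>poisson_law (t - s)) \<partial>poisson_law s)"
      by (simp add: \<pi>_def)
    thus "transport_cost nat_dist \<pi> \<le> ennreal (t - s)" using that by (simp add: nn_integral_poisson_law_mean)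
  qed
  show ?thesis
  proof (cases "s \<le> t")
    case True
    thus ?thesis using *[of s t] assms by simp
  next
    case False
    then obtain \<pi> where \<pi>: "\<pi> \<in> couplings (poisson_law t) (poisson_law s)" "transport_cost nat_dist \<pi> \<le> ennreal (s - t)"
      using *[of t s] assms by auto
    have "map_pmf (\<lambda>z. (snd z, fst z)) \<pi> \<in> couplings (poisson_law s) (poisson_law t)"
      using \<pi>(1) by (simp add: couplings_def map_pmf_comp)
    moreover have "transport_cost nat_dist (map_pmf (\<lambda>z. (snd z, fst z)) \<pi>) = transport_cost nat_dist \<pi>"
      by (simp add: abs_minus_commute)
    ultimately show ?thesis using \<pi>(2) False by (intro bexI[of _ "map_pmf (\<lambda>z. (snd z, fst z)) \<pi>"]) auto
  qed
qed

section \<open>Laplace transforms of Lipschitz functions\<close>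

text \<open>The log-Laplace transform of a centred Poisson variable of intensity 1. Its Legendre
  transform is \<open>hfun\<close>, which is how \<open>hfun\<close> arises in the final
  bound.\<close>

definition phi :: "real \<Rightarrow> real" where
  "phi x = exp x - 1 - x"

lemma phi_nonneg: "0 \<le> phi x"
  unfolding phi_def using exp_ge_add_one_self[of x] by linarith

lemma phi_mono:
  assumes "0 \<le> x" "x \<le> y"
  shows "phi x \<le> phi y"
proof (rule DERIV_nonneg_imp_nondecreasing[OF assms(2)])
  fix u assume "x \<le> u" "u \<le> y"
  thus "\<exists>d. (phi has_real_derivative d) (at u) \<and> 0 \<le> d"
    unfolding phi_def using assms by (intro exI[of _ "exp u - 1"]) (auto intro!: derivative_eq_intros)
qed

text \<open>For negative \<open>u\<close> this is the inequality sinh v \<ge> v at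
  \<open>v = - u\<close>.\<close>

lemma phi_le_phi_abs: "phi u \<le> phi \<bar>u\<bar>"
proof (cases "0 \<le> u")
  case False
  define f where "f v = exp v - exp (- v) - 2 * v" for v :: real
  have "f 0 \<le> f (- u)"
  proof (rule DERIV_nonneg_imp_nondecreasing[where f = f])
    fix x :: real
    have "0 \<le> (exp (x/2) - exp (- x/2))\<^sup>2" by simp
    also have "\<dots> = exp x + exp (- x) - 2"
      by (simp add: power2_diff exp_double[symmetric] flip: exp_add)
    finally show "\<exists>y. (f has_real_derivative y) (at x) \<and> 0 \<le> y"
      unfolding f_def by (intro exI[of _ "exp x + exp (- x) - 2"]) (auto intro!: derivative_eq_intros)
  qed (use False in auto)
  thus ?thesis using False by (simp add: phi_def f_def)
qed simp

lemma phi_ge_square: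
  assumes "0 \<le> x"
  shows "x\<^sup>2 / 2 \<le> phi x"
  using exp_lower_Taylor_quadratic[OF assms] by (simp add: phi_def)

lemma lip_bound:
  fixes g :: "nat \<Rightarrow> real"
  assumes "\<And>n. \<bar>g (Suc n) - g n\<bar> \<le> 1"
  shows "\<bar>g (x + n) - g x\<bar> \<le> real n"
proof (induction n)
  case (Suc n)
  thus ?case using assms[of "x + n"] by simp
qed simp

lemma lipmgfI:
  assumes "\<And>g B. (\<And>n. \<bar>g n\<bar> \<le> B) \<Longrightarrow> (\<And>n. \<bar>g (Suc n) - g n\<bar> \<le> 1) \<Longrightarrow>
     measure_pmf.expectation p (\<lambda>n. exp (l * g n)) \<le> exp (l * measure_pmf.expectation p g + \<kappa>)"
  shows "lipschitz_mgf l \<kappa> p"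
  using assms unfolding lipschitz_mgf_def by blast

lemma lipmgfD:
  assumes "lipschitz_mgf l \<kappa> p" "\<And>n. \<bar>g n\<bar> \<le> B" "\<And>n. \<bar>g (Suc n) - g n\<bar> \<le> 1"
  shows "measure_pmf.expectation p (\<lambda>n. exp (l * g n)) \<le> exp (l * measure_pmf.expectation p g + \<kappa>)"
  using assms unfolding lipschitz_mgf_def by blast

lemma integrable_exp_bounded:
  fixes g :: "'a \<Rightarrow> real"
  assumes "\<And>n. \<bar>g n\<bar> \<le> B" "0 \<le> l"
  shows "integrable (measure_pmf p) (\<lambda>n. exp (l * g n))"
proof (rule integrable_measure_pmf_bounded)
  fix n
  have "l * g n \<le> l * B" using assms(1)[of n] assms(2) by (intro mult_left_mono) auto
  thus "\<bar>exp (l * g n)\<bar> \<le> exp (l * B)" by simp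
qed

text \<open>Freeze the first summand and use the bound for \<open>q\<close> on a translate of
  \<open>g\<close>. The averaged function \<open>m\<close> is again bounded with steps at most 1, so
  the bound for \<open>p\<close> applies to it.\<close>

lemma lipschitz_mgf_nat_convolution:
  assumes p: "lipschitz_mgf l \<kappa>1 p" and q: "lipschitz_mgf l \<kappa>2 q" and l: "0 \<le> l"
  shows "lipschitz_mgf l (\<kappa>1 + \<kappa>2) (nat_convolution p q)"
proof (rule lipmgfI)
  fix g :: "nat \<Rightarrow> real" and B
  assume B: "\<And>n. \<bar>g n\<bar> \<le> B" and L: "\<And>n. \<bar>g (Suc n) - g n\<bar> \<le> 1"
  define m where "m x = measure_pmf.expectation q (\<lambda>y. g (x + y))" for x
  have Bm: "\<bar>m x\<bar> \<le> B" for x unfolding m_def by (rule abs_expectation_le) (rule B)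
  have Ig: "integrable (measure_pmf q) (\<lambda>y. g (x + y))" for x
    by (rule integrable_measure_pmf_bounded) (rule B)
  have Lm: "\<bar>m (Suc x) - m x\<bar> \<le> 1" for x
  proof -
    have "m (Suc x) - m x = measure_pmf.expectation q (\<lambda>y. g (Suc (x + y)) - g (x + y))"
      unfolding m_def using Ig[of "Suc x"] Ig[of x] by simp
    also have "\<bar>\<dots>\<bar> \<le> 1" by (rule abs_expectation_le) (rule L)
    finally show ?thesis .
  qed
  have BE: "\<bar>exp (l * g n)\<bar> \<le> exp (l * B)" for n
    using mult_left_mono[OF abs_le_D1[OF B[of n]] l] by simp
  have "measure_pmf.expectation (nat_convolution p q) (\<lambda>n. exp (l * g n))
     = measure_pmf.expectation p (\<lambda>x. measure_pmf.expectation q (\<lambda>y. exp (l * g (x + y))))"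
    unfolding nat_convolution_def by (subst expectation_bind_pmf[OF BE]) simp
  also have "\<dots> \<le> measure_pmf.expectation p (\<lambda>x. exp (l * m x) * exp \<kappa>2)"
  proof (intro integral_mono)
    show "integrable (measure_pmf p) (\<lambda>x. measure_pmf.expectation q (\<lambda>y. exp (l * g (x + y))))"
      by (rule integrable_measure_pmf_bounded) (rule abs_expectation_le, rule BE)
    show "integrable (measure_pmf p) (\<lambda>x. exp (l * m x) * exp \<kappa>2)"
      using integrable_exp_bounded[of m B l p] Bm l by simp
    fix x
    show "measure_pmf.expectation q (\<lambda>y. exp (l * g (x + y))) \<le> exp (l * m x) * exp \<kappa>2"
      using lipmgfD[OF q, of "\<lambda>y. g (x + y)" B] B L by (simp add: m_def exp_add)
  qed
  also have "\<dots> = exp \<kappa>2 * measure_pmf.expectation p (\<lambda>x. exp (l * m x))" by simp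
  also have "\<dots> \<le> exp \<kappa>2 * exp (l * measure_pmf.expectation p m + \<kappa>1)"
    using lipmgfD[OF p, of m B] Bm Lm by (intro mult_left_mono) auto
  also have "measure_pmf.expectation p m = measure_pmf.expectation (nat_convolution p q) g"
    unfolding nat_convolution_def by (subst expectation_bind_pmf[OF B]) (simp add: m_def[abs_def])
  finally show "measure_pmf.expectation (nat_convolution p q) (\<lambda>n. exp (l * g n))
     \<le> exp (l * measure_pmf.expectation (nat_convolution p q) g + (\<kappa>1 + \<kappa>2))"
    by (simp add: exp_add ac_simps)
qed

text \<open>The constant is the Poisson mean of \<open>phi (l * real n)\<close>, which dominates
  \<open>phi\<close> of the deviation \<open>l * (g n - g 0)\<close>; the logarithm is then bounded
  through \<open>ln x \<le> x - 1\<close>. As \<open>t\<close> tends to 0 the constant agrees with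
  \<open>t * phi l\<close> to first order, which is all that a subdivision of the intensity
  requires.\<close>

lemma lipschitz_mgf_poisson_law_crude:
  assumes t: "0 \<le> t" and l: "0 \<le> l"
  shows "lipschitz_mgf l (exp (t * (exp l - 1)) - 1 - l * t) (poisson_law t)"
proof (rule lipmgfI)
  fix g :: "nat \<Rightarrow> real" and B
  assume B: "\<And>n. \<bar>g n\<bar> \<le> B" and L: "\<And>n. \<bar>g (Suc n) - g n\<bar> \<le> 1"
  let ?E = "measure_pmf.expectation (poisson_law t)"
  define u where "u n = l * (g n - g 0)" for n
  have Ig: "integrable (measure_pmf (poisson_law t)) g" by (rule integrable_measure_pmf_bounded[OF B])
  have Iu: "integrable (measure_pmf (poisson_law t)) u" unfolding u_def using Ig by simp
  have "integrable (measure_pmf (poisson_law t)) (\<lambda>n. exp (- (l * g 0)) * exp (l * g n))"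
    using integrable_exp_bounded[of g B l] B l by simp
  moreover have eu: "exp (u n) = exp (- (l * g 0)) * exp (l * g n)" for n
    by (simp add: u_def algebra_simps flip: exp_add)
  ultimately have Ie: "integrable (measure_pmf (poisson_law t)) (\<lambda>n. exp (u n))" by simp
  note mgf = poisson_law_mgf[OF t, of l] and mean = poisson_law_mean[OF t]
  have Iphi: "integrable (measure_pmf (poisson_law t)) (\<lambda>n. phi (l * real n))"
    unfolding phi_def using mgf mean by (auto simp: has_bochner_integral_iff)
  have Ephi: "?E (\<lambda>n. phi (l * real n)) = exp (t * (exp l - 1)) - 1 - l * t"
    unfolding phi_def using mgf mean by (simp add: has_bochner_integral_iff)
  have "phi (u n) \<le> phi (l * real n)" for n
  proof -
    have "\<bar>u n\<bar> \<le> l * real n"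
      unfolding u_def abs_mult using lip_bound[of g 0 n] L l by (intro mult_mono) auto
    thus ?thesis using phi_le_phi_abs[of "u n"] phi_mono[of "\<bar>u n\<bar>" "l * real n"] by simp
  qed
  hence pw: "exp (u n) - 1 \<le> u n + phi (l * real n)" for n
    using phi_def[of "u n"] by (smt (verit))
  have "?E (\<lambda>n. exp (u n)) - 1 = ?E (\<lambda>n. exp (u n) - 1)" using Ie by simp
  also have "\<dots> \<le> ?E (\<lambda>n. u n + phi (l * real n))"
    by (intro integral_mono pw) (use Ie Iu Iphi in auto)
  also have "\<dots> = l * (?E g - g 0) + (exp (t * (exp l - 1)) - 1 - l * t)"
    using Iu Iphi Ig by (simp add: Ephi) (simp add: u_def[abs_def])
  finally have le: "?E (\<lambda>n. exp (u n)) - 1 \<le> l * (?E g - g 0) + (exp (t * (exp l - 1)) - 1 - l * t)" .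
  have "?E (\<lambda>n. exp (l * g n)) = exp (l * g 0) * ?E (\<lambda>n. exp (u n))"
    by (simp add: eu exp_minus)
  also have "\<dots> \<le> exp (l * g 0) * exp (l * (?E g - g 0) + (exp (t * (exp l - 1)) - 1 - l * t))"
  proof (intro mult_left_mono)
    have "?E (\<lambda>n. exp (u n)) \<le> exp (?E (\<lambda>n. exp (u n)) - 1)"
      using exp_ge_add_one_self[of "?E (\<lambda>n. exp (u n)) - 1"] by simp
    thus "?E (\<lambda>n. exp (u n)) \<le> exp (l * (?E g - g 0) + (exp (t * (exp l - 1)) - 1 - l * t))"
      using le by (meson exp_le_cancel_iff order_trans)
  qed simp
  also have "\<dots> = exp (l * ?E g + (exp (t * (exp l - 1)) - 1 - l * t))"
    by (simp add: algebra_simps flip: exp_add)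
  finally show "?E (\<lambda>n. exp (l * g n)) \<le> exp (l * ?E g + (exp (t * (exp l - 1)) - 1 - l * t))" .
qed

text \<open>Split the Poisson law into \<open>n\<close> independent ones of intensity \<open>t / n\<close> and let \<open>n\<close> tend to infinity.\<close>

lemma lipschitz_mgf_poisson_law:
  assumes t: "0 \<le> t" and l: "0 \<le> l"
  shows "lipschitz_mgf l (t * phi l) (poisson_law t)"
proof -
  have iter: "lipschitz_mgf l (real n * (exp (e * (exp l - 1)) - 1 - l * e)) (poisson_law (real n * e))" if "0 \<le> e" for n e
  proof (induction n)
    case 0
    show ?case by (simp add: poisson_law_def lipschitz_mgf_def)
  next
    case (Suc n)
    have "lipschitz_mgf l (real n * (exp (e * (exp l - 1)) - 1 - l * e) + (exp (e * (exp l - 1)) - 1 - l * e))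
       (nat_convolution (poisson_law (real n * e)) (poisson_law e))"
      by (intro lipschitz_mgf_nat_convolution Suc lipschitz_mgf_poisson_law_crude that l)
    thus ?case using that by (simp add: nat_convolution_poisson_law algebra_simps)
  qed
  show ?thesis
  proof (rule lipmgfI)
    fix g :: "nat \<Rightarrow> real" and B
    assume B: "\<And>n. \<bar>g n\<bar> \<le> B" and L: "\<And>n. \<bar>g (Suc n) - g n\<bar> \<le> 1"
    let ?E = "measure_pmf.expectation (poisson_law t)"
    define a where "a = t * (exp l - 1)"
    have a: "0 \<le> a" using t l by (simp add: a_def)
    have ev: "?E (\<lambda>n. exp (l * g n)) \<le> exp (l * ?E g + (t * phi l + a\<^sup>2 / real n))"
      if n: "n \<ge> nat \<lceil>a\<rceil> + 1" for n
    proof -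
      have n0: "0 < real n" "a \<le> real n" using n by linarith+
      have "real n * (exp (t / real n * (exp l - 1)) - 1 - l * (t / real n)) = real n * (exp (a / real n) - 1) - l * t"
        using n0 by (simp add: a_def field_simps)
      \<comment> \<open>For \<open>x = a / real n\<close> in [0,1] one has
        \<open>exp x \<le> 1 + x + x\<^sup>2\<close>, which is why \<open>n\<close> is taken at
        least \<open>a\<close>. The resulting error \<open>a\<^sup>2 / real n\<close> vanishes in
        the limit.\<close>
      also have "\<dots> \<le> real n * (a / real n + (a / real n)\<^sup>2) - l * t"
        using mult_left_mono[of "exp (a / real n) - 1" "a / real n + (a / real n)\<^sup>2" "real n"]
          exp_bound[of "a / real n"] n0 a by simp
      also have "\<dots> = t * phi l + a\<^sup>2 / real n"
        using n0 by (simp add: phi_def a_def field_simps power2_eq_square)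
      finally have le: "real n * (exp (t / real n * (exp l - 1)) - 1 - l * (t / real n)) \<le> t * phi l + a\<^sup>2 / real n" .
      have "?E (\<lambda>n. exp (l * g n)) \<le> exp (l * ?E g + real n * (exp (t / real n * (exp l - 1)) - 1 - l * (t / real n)))"
        using lipmgfD[OF iter[of "t / real n" n], of g B] B L t n0 by simp
      also have "\<dots> \<le> exp (l * ?E g + (t * phi l + a\<^sup>2 / real n))" using le by simp
      finally show ?thesis .
    qed
    have "(\<lambda>n. exp (l * ?E g + (t * phi l + a\<^sup>2 / real n))) \<longlonglongrightarrow> exp (l * ?E g + (t * phi l + 0))"
      by (intro tendsto_intros lim_const_over_n)
    from LIMSEQ_le_const[OF this] show "?E (\<lambda>n. exp (l * g n)) \<le> exp (l * ?E g + t * phi l)"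
      using ev by auto
  qed
qed

text \<open>Raising the intensity from \<open>s\<close> to \<open>t\<close> adds an independent
  Poisson variable of mean \<open>t - s\<close>, and \<open>g\<close> moves by at most that
  variable. In a Poisson mixture this confines the conditional means to an interval no longer than
  the range of the intensity.\<close>

lemma poisson_law_expectation_lipschitz:
  assumes B: "\<And>n. \<bar>g n\<bar> \<le> B" and L: "\<And>n. \<bar>g (Suc n) - g n\<bar> \<le> 1" and st: "0 \<le> s" "s \<le> t"
  shows "\<bar>measure_pmf.expectation (poisson_law t) g - measure_pmf.expectation (poisson_law s) g\<bar> \<le> t - s"
proof -
  define m where "m x = measure_pmf.expectation (poisson_law (t - s)) (\<lambda>y. g (x + y))" for x
  have Bm: "\<bar>m x\<bar> \<le> B" for x unfolding m_def by (rule abs_expectation_le) (rule B)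
  have "measure_pmf.expectation (poisson_law t) g = measure_pmf.expectation (nat_convolution (poisson_law s) (poisson_law (t - s))) g"
    using nat_convolution_poisson_law[of s "t - s"] st by simp
  also have "\<dots> = measure_pmf.expectation (poisson_law s) m"
    unfolding nat_convolution_def by (subst expectation_bind_pmf[OF B]) (simp add: m_def[abs_def])
  finally have "measure_pmf.expectation (poisson_law t) g - measure_pmf.expectation (poisson_law s) g
     = measure_pmf.expectation (poisson_law s) (\<lambda>x. m x - g x)"
    using integrable_measure_pmf_bounded[OF B, of "poisson_law s"] integrable_measure_pmf_bounded[OF Bm, of "poisson_law s"] by simp
  also have "\<bar>\<dots>\<bar> \<le> t - s"
  proof (rule abs_expectation_le)
    fix x
    have I: "integrable (measure_pmf (poisson_law (t - s))) (\<lambda>y. g (x + y))"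
      by (rule integrable_measure_pmf_bounded) (rule B)
    have mean: "has_bochner_integral (measure_pmf (poisson_law (t - s))) real (t - s)" using st by (intro poisson_law_mean) simp
    have "m x - g x = measure_pmf.expectation (poisson_law (t - s)) (\<lambda>y. g (x + y) - g x)"
      using I by (simp add: m_def)
    also have "\<bar>\<dots>\<bar> \<le> measure_pmf.expectation (poisson_law (t - s)) (\<lambda>y. \<bar>g (x + y) - g x\<bar>)"
      by (rule integral_abs_bound)
    also have "\<dots> \<le> measure_pmf.expectation (poisson_law (t - s)) real"
      by (intro integral_mono) (use I mean lip_bound[of g, OF L] in \<open>auto simp: has_bochner_integral_iff\<close>)
    also have "\<dots> = t - s" using mean by (simp add: has_bochner_integral_iff)
    finally show "\<bar>m x - g x\<bar> \<le> t - s" .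
  qed
  finally show ?thesis .
qed

lemma lipschitz_mgf_mixed_poisson_law:
  assumes T: "\<And>y. 0 \<le> T y \<and> T y \<le> t" and l: "0 \<le> l"
  shows "lipschitz_mgf l ((t + t\<^sup>2 / 4) * phi l) (bind_pmf r (\<lambda>y. poisson_law (T y)))"
proof (cases "l = 0")
  case True
  thus ?thesis by (simp add: lipschitz_mgf_def phi_def)
next
  case False
  hence l0: "0 < l" using l by simp
  show ?thesis
  proof (rule lipmgfI)
    fix g :: "nat \<Rightarrow> real" and B
    assume B: "\<And>n. \<bar>g n\<bar> \<le> B" and L: "\<And>n. \<bar>g (Suc n) - g n\<bar> \<le> 1"
    define p where "p = bind_pmf r (\<lambda>y. poisson_law (T y))"
    define h where "h s = measure_pmf.expectation (poisson_law s) g" for s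
    let ?m = "\<lambda>y. h (T y)"
    have t0: "0 \<le> t" using T[of undefined] by linarith
    have h: "\<bar>h s - h s'\<bar> \<le> \<bar>s - s'\<bar>" if "0 \<le> s" "0 \<le> s'" for s s'
      using poisson_law_expectation_lipschitz[of g B, OF B L, of s s'] poisson_law_expectation_lipschitz[of g B, OF B L, of s' s] that
      unfolding h_def by (cases "s \<le> s'") (auto simp: abs_minus_commute)
    have Bh: "\<bar>h s\<bar> \<le> B" for s unfolding h_def by (rule abs_expectation_le) (rule B)
    \<comment> \<open>Measured from the intensity \<open>t/2\<close>, all conditional means lie in
      an interval of length \<open>t\<close>, whence Hoeffding's exponent
      \<open>l\<^sup>2 * t\<^sup>2 / 8\<close>.\<close>
    have iv: "?m y \<in> {h (t/2) - t/2 .. h (t/2) + t/2}" for y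
    proof -
      have "\<bar>?m y - h (t/2)\<bar> \<le> \<bar>T y - t/2\<bar>" using h[of "T y" "t/2"] T[of y] t0 by simp
      also have "\<dots> \<le> t/2" using T[of y] by linarith
      finally show ?thesis unfolding atLeastAtMost_iff by linarith
    qed
    have BE: "\<bar>exp (l * g n)\<bar> \<le> exp (l * B)" for n
      using mult_left_mono[OF abs_le_D1[OF B[of n]] l] by simp
    have Em: "measure_pmf.expectation p g = measure_pmf.expectation r ?m"
      unfolding p_def h_def by (rule expectation_bind_pmf[OF B])
    let ?\<mu> = "measure_pmf.expectation r ?m"
    interpret ibrv: interval_bounded_random_variable "measure_pmf r" ?m "h (t/2) - t/2" "h (t/2) + t/2"
      by unfold_locales (use iv in auto)
    have hoef: "measure_pmf.expectation r (\<lambda>y. exp (l * (?m y - ?\<mu>))) \<le> exp (l\<^sup>2 * t\<^sup>2 / 8)"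
    proof -
      have "\<bar>?m y - ?\<mu>\<bar> \<le> B + B" for y
        using Bh[of "T y"] abs_expectation_le[of ?m B r] Bh by (smt (verit))
      hence I: "integrable (measure_pmf r) (\<lambda>y. exp (l * (?m y - ?\<mu>)))"
        by (rule integrable_exp_bounded[OF _ l])
      have "ennreal (measure_pmf.expectation r (\<lambda>y. exp (l * (?m y - ?\<mu>))))
         = (\<integral>\<^sup>+y. ennreal (exp (l * (?m y - ?\<mu>))) \<partial>measure_pmf r)"
        by (rule nn_integral_eq_integral[OF I, symmetric]) simp
      also have "\<dots> \<le> ennreal (exp (l\<^sup>2 * t\<^sup>2 / 8))"
        using ibrv.Hoeffdings_lemma_nn_integral[OF l0] by simp
      finally show ?thesis by simp
    qed
    have "measure_pmf.expectation p (\<lambda>n. exp (l * g n))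
       = measure_pmf.expectation r (\<lambda>y. measure_pmf.expectation (poisson_law (T y)) (\<lambda>n. exp (l * g n)))"
      unfolding p_def by (rule expectation_bind_pmf[OF BE])
    also have "\<dots> \<le> measure_pmf.expectation r (\<lambda>y. exp (l * ?m y) * exp (t * phi l))"
    proof (intro integral_mono)
      show "integrable (measure_pmf r) (\<lambda>y. measure_pmf.expectation (poisson_law (T y)) (\<lambda>n. exp (l * g n)))"
        by (rule integrable_measure_pmf_bounded) (rule abs_expectation_le, rule BE)
      show "integrable (measure_pmf r) (\<lambda>y. exp (l * ?m y) * exp (t * phi l))"
        using integrable_exp_bounded[of ?m B l r] Bh l by simp
      fix y
      have "measure_pmf.expectation (poisson_law (T y)) (\<lambda>n. exp (l * g n)) \<le> exp (l * ?m y + T y * phi l)"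
        unfolding h_def using lipmgfD[OF lipschitz_mgf_poisson_law, of "T y" l g B] T[of y] l B L by simp
      also have "\<dots> \<le> exp (l * ?m y + t * phi l)"
        using T[of y] phi_nonneg[of l] by (simp add: mult_right_mono)
      finally show "measure_pmf.expectation (poisson_law (T y)) (\<lambda>n. exp (l * g n)) \<le> exp (l * ?m y) * exp (t * phi l)"
        by (simp add: exp_add)
    qed
    also have "\<dots> = exp (t * phi l) * exp (l * ?\<mu>) * measure_pmf.expectation r (\<lambda>y. exp (l * (?m y - ?\<mu>)))"
      by (simp add: right_diff_distrib exp_diff)
    also have "\<dots> \<le> exp (t * phi l) * exp (l * ?\<mu>) * exp (l\<^sup>2 * t\<^sup>2 / 8)"
      by (intro mult_left_mono hoef) auto
    \<comment> \<open>The exponent is regrouped as \<open>t\<^sup>2 / 4\<close> times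
      \<open>l\<^sup>2 / 2\<close>, the quantity that \<open>phi l\<close> dominates.\<close>
    also have "\<dots> = exp (l * ?\<mu> + (t * phi l + t\<^sup>2 / 4 * (l\<^sup>2 / 2)))"
      by (simp add: algebra_simps flip: exp_add)
    also have "\<dots> \<le> exp (l * ?\<mu> + (t + t\<^sup>2 / 4) * phi l)"
      using mult_left_mono[OF phi_ge_square[OF l], of "t\<^sup>2 / 4"] by (simp add: distrib_right)
    finally show "measure_pmf.expectation (bind_pmf r (\<lambda>y. poisson_law (T y))) (\<lambda>n. exp (l * g n))
      \<le> exp (l * measure_pmf.expectation (bind_pmf r (\<lambda>y. poisson_law (T y))) g + (t + t\<^sup>2 / 4) * phi l)"
      using Em by (simp add: p_def)
  qed
qed

section \<open>Gibbs measures\<close>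

text \<open>The bound \<open>w x \<le> 1\<close> makes the total weight finite and the atom
  \<open>x0\<close> makes it positive, so it can be normalised. Existence of the Gibbs measures
  rests on this.\<close>

lemma pmf_reweight_exists:
  fixes w :: "'a \<Rightarrow> real"
  assumes w: "\<And>x. 0 \<le> w x" "\<And>x. w x \<le> 1" and x0: "x0 \<in> set_pmf \<mu>" "0 < w x0"
  shows "\<exists>\<nu> c. \<forall>x. pmf \<nu> x = c * (pmf \<mu> x * w x)"
proof -
  have I: "integrable (measure_pmf \<mu>) w"
    by (rule integrable_measure_pmf_bounded[where B = 1]) (use w in auto)
  define Z where "Z = measure_pmf.expectation \<mu> w"
  have "Z \<noteq> 0"
  proof
    assume "Z = 0"
    hence "AE x in measure_pmf \<mu>. w x = 0"
      using integral_nonneg_eq_0_iff_AE[OF I] w by (simp add: Z_def)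
    thus False using x0 by (auto simp: AE_measure_pmf_iff)
  qed
  moreover have "Z \<ge> 0" unfolding Z_def by (rule Bochner_Integration.integral_nonneg) (use w in auto)
  ultimately have Z: "0 < Z" by simp
  define f where "f x = (1 / Z) * (pmf \<mu> x * w x)" for x
  have f0: "0 \<le> f x" for x using Z w by (simp add: f_def)
  have "(\<integral>\<^sup>+x. ennreal (f x) \<partial>count_space UNIV)
      = (\<integral>\<^sup>+x. ennreal (1 / Z) * (ennreal (pmf \<mu> x) * ennreal (w x)) \<partial>count_space UNIV)"
    using Z w by (simp add: f_def flip: ennreal_mult)
  also have "\<dots> = ennreal (1 / Z) * (\<integral>\<^sup>+x. ennreal (w x) \<partial>measure_pmf \<mu>)"
    by (simp add: nn_integral_cmult nn_integral_measure_pmf)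
  also have "(\<integral>\<^sup>+x. ennreal (w x) \<partial>measure_pmf \<mu>) = ennreal Z"
    unfolding Z_def by (rule nn_integral_eq_integral[OF I]) (use w in auto)
  also have "ennreal (1 / Z) * ennreal Z = 1" using Z by (simp flip: ennreal_mult)
  finally have "(\<integral>\<^sup>+x. ennreal (f x) \<partial>count_space UNIV) = 1" .
  hence "pmf (embed_pmf f) x = (1 / Z) * (pmf \<mu> x * w x)" for x
    using pmf_embed_pmf[of f] f0 by (simp add: f_def)
  thus ?thesis by blast
qed

definition confs :: "nat set \<Rightarrow> (nat \<Rightarrow> nat) set" where
  "confs J = {x. \<forall>i. i \<notin> J \<longrightarrow> x i = 0}"

definition pairs :: "nat set \<Rightarrow> (nat \<times> nat) set" where
  "pairs J = {(i, j). i \<in> J \<and> j \<in> J \<and> i < j}"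

lemma finite_pairs: "finite J \<Longrightarrow> finite (pairs J)"
  by (rule finite_subset[of _ "J \<times> J"]) (auto simp: pairs_def)

lemma confs_insert_iff: "k \<notin> J \<Longrightarrow> x \<in> confs (insert k J) \<longleftrightarrow> x(k := 0) \<in> confs J"
  by (auto simp: confs_def)

text \<open>\<open>a i j\<close> stands for exp(- gamma_ij). These weights turn an infinite
  interaction into the ordinary value 0, and \<open>0 ^ 0 = 1\<close> reproduces the convention that
  an infinite interaction with an empty site costs nothing. The diagonal value 1 says that a site
  does not act on itself.\<close>

locale interaction =
  fixes a :: "nat \<Rightarrow> nat \<Rightarrow> real"
  assumes a_nonneg: "0 \<le> a i j" and a_le_1: "a i j \<le> 1"
    and a_sym: "a i j = a j i" and a_diag: "a i i = 1"
begin

text \<open>The Poisson factors exp(- theta_i) are left to the normalising constant. The intensities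
  then enter through powers only, so that rescaling them is a multiplicative tilt.\<close>

definition gibbs_density :: "nat set \<Rightarrow> (nat \<Rightarrow> real) \<Rightarrow> (nat \<Rightarrow> nat) \<Rightarrow> real" where
  "gibbs_density J \<theta> x = (if x \<in> confs J then (\<Prod>i\<in>J. \<theta> i ^ x i / fact (x i)) * (\<Prod>(i,j)\<in>pairs J. a i j ^ (x i * x j)) else 0)"

text \<open>The factor by which the other sites reduce the Poisson intensity at \<open>k\<close>.
  Since \<open>a k k = 1\<close>, the value is the same whether or not \<open>k\<close> belongs to
  \<open>J\<close>.\<close>

definition damping :: "nat set \<Rightarrow> nat \<Rightarrow> (nat \<Rightarrow> nat) \<Rightarrow> real" where
  "damping J k x = (\<Prod>j\<in>J. a k j ^ x j)"

text \<open>For finite \<open>J\<close> and nonnegative intensities such a law exists by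
  \<open>pmf_gibbs_law\<close> and is unique by \<open>pmf_proportional_unique\<close>.\<close>

definition gibbs_law :: "nat set \<Rightarrow> (nat \<Rightarrow> real) \<Rightarrow> (nat \<Rightarrow> nat) pmf" where
  "gibbs_law J \<theta> = (SOME \<mu>. \<exists>c. \<forall>x. pmf \<mu> x = c * gibbs_density J \<theta> x)"

lemma damping_bounds: "0 \<le> damping J k x" "damping J k x \<le> 1"
  unfolding damping_def
  by (auto intro!: prod_nonneg prod_le_1 power_le_one zero_le_power simp: a_nonneg a_le_1)

lemma damping_upd: "damping J k (x(k := n)) = damping J k x"
  unfolding damping_def by (intro prod.cong) (auto simp: a_diag)

lemma damping_insert: "finite J \<Longrightarrow> damping (insert k J) k x = damping J k x"
  unfolding damping_def by (cases "k \<in> J") (auto simp: a_diag insert_absorb)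

text \<open>Relative to the product of Poisson laws the interaction weight is at most 1, and it
  equals 1 at the empty configuration, which therefore survives even hard-core exclusion.\<close>

lemma pmf_gibbs_law:
  assumes J: "finite J" and \<theta>: "\<forall>i\<in>J. 0 \<le> \<theta> i"
  shows "\<exists>c. \<forall>x. pmf (gibbs_law J \<theta>) x = c * gibbs_density J \<theta> x"
proof -
  define \<mu> where "\<mu> = Pi_pmf J 0 (\<lambda>i. poisson_law (\<theta> i))"
  define w where "w x = (\<Prod>(i,j)\<in>pairs J. a i j ^ (x i * x j))" for x :: "nat \<Rightarrow> nat"
  have w: "0 \<le> w x" "w x \<le> 1" for x unfolding w_def
    by (auto intro!: prod_nonneg prod_le_1 power_le_one zero_le_power simp: a_nonneg a_le_1)
  have pm: "pmf \<mu> x = (if x \<in> confs J then (\<Prod>i\<in>J. exp (- \<theta> i) * \<theta> i ^ x i / fact (x i)) else 0)" for x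
    using \<theta> by (auto simp: \<mu>_def pmf_Pi[OF J] confs_def pmf_poisson_law)
  have "pmf \<mu> (\<lambda>_. 0) = (\<Prod>i\<in>J. exp (- \<theta> i))"
    by (simp add: pm confs_def)
  also have "\<dots> > 0" by (intro prod_pos) auto
  finally have "(\<lambda>_. 0) \<in> set_pmf \<mu>" by (simp add: set_pmf_iff)
  moreover have "0 < w (\<lambda>_. 0)" by (simp add: w_def split_beta)
  ultimately obtain \<nu> c where \<nu>: "\<And>x. pmf \<nu> x = c * (pmf \<mu> x * w x)"
    using pmf_reweight_exists[of w, OF w] by blast
  define e where "e = (\<Prod>i\<in>J. exp (- \<theta> i))"
  have "pmf \<mu> x * w x = e * gibbs_density J \<theta> x" for x
    by (simp add: pm gibbs_density_def w_def e_def prod.distrib[symmetric])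
  hence "\<forall>x. pmf \<nu> x = (c * e) * gibbs_density J \<theta> x" using \<nu> by simp
  hence "\<exists>\<mu> c. \<forall>x. pmf \<mu> x = c * gibbs_density J \<theta> x" by blast
  thus ?thesis unfolding gibbs_law_def by (rule someI_ex)
qed

lemma set_gibbs_law:
  assumes "finite J" "\<forall>i\<in>J. 0 \<le> \<theta> i"
  shows "set_pmf (gibbs_law J \<theta>) \<subseteq> confs J"
  using pmf_gibbs_law[OF assms] by (auto simp: set_pmf_iff gibbs_density_def split: if_splits)

lemma pairs_prod_insert:
  assumes J: "finite J" "k \<notin> J"
  shows "(\<Prod>(i,j)\<in>pairs (insert k J). a i j ^ (x i * x j))
       = damping J k x ^ x k * (\<Prod>(i,j)\<in>pairs J. a i j ^ (x i * x j))"
proof -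
  \<comment> \<open>A pair containing \<open>k\<close> is determined by its other site;
    \<open>?s\<close> puts the two sites in the increasing order that \<open>pairs\<close>
    uses.\<close>
  let ?s = "\<lambda>j. (min j k, max j k)" and ?f = "\<lambda>(i,j). a i j ^ (x i * x j)"
  have split: "pairs (insert k J) = pairs J \<union> ?s ` J"
  proof (intro set_eqI iffI)
    fix p assume "p \<in> pairs (insert k J)"
    then obtain i j where p: "p = (i, j)" "i \<in> insert k J" "j \<in> insert k J" "i < j" by (auto simp: pairs_def)
    show "p \<in> pairs J \<union> ?s ` J"
    proof (cases "i \<in> J \<and> j \<in> J")
      case True thus ?thesis using p by (auto simp: pairs_def)
    next
      case False
      hence "(i = k \<and> j \<in> J) \<or> (j = k \<and> i \<in> J)" using p by auto
      thus ?thesis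
      proof
        assume "i = k \<and> j \<in> J" thus ?thesis using p by (intro UnI2 image_eqI[of _ _ j]) auto
      next
        assume "j = k \<and> i \<in> J" thus ?thesis using p by (intro UnI2 image_eqI[of _ _ i]) auto
      qed
    qed
  next
    fix p assume p: "p \<in> pairs J \<union> ?s ` J"
    have "?s j \<in> pairs (insert k J)" if "j \<in> J" for j
      using that J by (cases j k rule: linorder_cases) (auto simp: pairs_def min_def max_def)
    thus "p \<in> pairs (insert k J)" using p by (auto simp: pairs_def)
  qed
  have disj: "pairs J \<inter> ?s ` J = {}"
    using J by (auto simp: pairs_def min_def max_def split: if_splits)
  have inj: "inj_on ?s J"
    by (auto simp: inj_on_def min_def max_def split: if_splits)
  have "(\<Prod>p\<in>?s ` J. ?f p) = (\<Prod>j\<in>J. ?f (?s j))"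
    by (subst prod.reindex[OF inj]) simp
  also have "\<dots> = (\<Prod>j\<in>J. (a k j ^ x j) ^ x k)"
    by (intro prod.cong) (auto simp: min_def max_def power_mult[symmetric] mult.commute a_sym[of k])
  also have "\<dots> = damping J k x ^ x k" by (simp add: damping_def prod_power_distrib)
  finally have "(\<Prod>p\<in>?s ` J. ?f p) = damping J k x ^ x k" .
  thus ?thesis unfolding split
    by (subst prod.union_disjoint[OF finite_pairs _ disj]) (use J in \<open>auto simp: mult.commute\<close>)
qed

text \<open>Both kinds of conditional law can be read off this factorisation: with the other sites
  fixed it is a Poisson weight in \<open>x k\<close>, and with \<open>x k\<close> fixed it is a
  tilted density on \<open>J\<close>.\<close>

lemma gibbs_density_insert:
  assumes J: "finite J" "k \<notin> J"
  shows "gibbs_density (insert k J) \<theta> x = (\<theta> k * damping J k x) ^ x k / fact (x k) * gibbs_density J \<theta> (x(k := 0))"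
proof (cases "x \<in> confs (insert k J)")
  case True
  hence x': "x(k := 0) \<in> confs J" using confs_insert_iff J by blast
  have "(\<Prod>i\<in>J. \<theta> i ^ (x(k := 0)) i / fact ((x(k := 0)) i)) = (\<Prod>i\<in>J. \<theta> i ^ x i / fact (x i))"
    using J by (intro prod.cong) auto
  moreover have "(\<Prod>(i,j)\<in>pairs J. a i j ^ ((x(k := 0)) i * (x(k := 0)) j)) = (\<Prod>(i,j)\<in>pairs J. a i j ^ (x i * x j))"
    using J by (intro prod.cong) (auto simp: pairs_def)
  ultimately have "gibbs_density J \<theta> (x(k := 0)) = (\<Prod>i\<in>J. \<theta> i ^ x i / fact (x i)) * (\<Prod>(i,j)\<in>pairs J. a i j ^ (x i * x j))"
    using x' by (simp only: gibbs_density_def if_True)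
  thus ?thesis using True J
    by (simp add: gibbs_density_def pairs_prod_insert power_mult_distrib)
next
  case False
  hence "x(k := 0) \<notin> confs J" using confs_insert_iff J by blast
  thus ?thesis using False by (simp add: gibbs_density_def)
qed

text \<open>Interaction with a site frozen at the value \<open>n\<close> acts on each remaining site
  separately, so it amounts to a change of intensities.\<close>

lemma gibbs_density_tilt: "gibbs_density J (\<lambda>i. \<theta> i * a k i ^ n) y = damping J k y ^ n * gibbs_density J \<theta> y"
proof -
  have "(\<Prod>i\<in>J. (\<theta> i * a k i ^ n) ^ y i / fact (y i)) = (\<Prod>i\<in>J. (a k i ^ y i) ^ n * (\<theta> i ^ y i / fact (y i)))"
    by (intro prod.cong) (auto simp: power_mult_distrib power_mult[symmetric] mult.commute)
  also have "\<dots> = damping J k y ^ n * (\<Prod>i\<in>J. \<theta> i ^ y i / fact (y i))"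
    unfolding damping_def prod.distrib prod_power_distrib[symmetric] ..
  finally show ?thesis by (simp add: gibbs_density_def)
qed

section \<open>Conditional laws and single-site updates of a Gibbs measure\<close>

lemma gibbs_law_cond_site:
  assumes J: "finite J" "k \<notin> J" and \<theta>: "\<forall>i\<in>insert k J. 0 \<le> \<theta> i"
    and n: "n \<in> set_pmf (map_pmf (\<lambda>x. x k) (gibbs_law (insert k J) \<theta>))"
  shows "cond_pmf (gibbs_law (insert k J) \<theta>) {x. x k = n}
       = map_pmf (\<lambda>y. y(k := n)) (gibbs_law J (\<lambda>i. \<theta> i * a k i ^ n))"
proof -
  let ?P = "gibbs_law (insert k J) \<theta>" and ?R = "gibbs_law J (\<lambda>i. \<theta> i * a k i ^ n)"
  have ne: "set_pmf ?P \<inter> {x. x k = n} \<noteq> {}" using n by auto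
  obtain c where c: "\<And>x. pmf ?P x = c * gibbs_density (insert k J) \<theta> x" using pmf_gibbs_law[of "insert k J" \<theta>] J \<theta> by auto
  have \<theta>n: "\<forall>i\<in>J. 0 \<le> \<theta> i * a k i ^ n" using \<theta> by (simp add: a_nonneg)
  obtain c' where c': "\<And>x. pmf ?R x = c' * gibbs_density J (\<lambda>i. \<theta> i * a k i ^ n) x" using pmf_gibbs_law[OF J(1) \<theta>n] by auto
  define w where "w x = (if x k = n then gibbs_density J (\<lambda>i. \<theta> i * a k i ^ n) (x(k := 0)) else 0)" for x
  have infl0: "damping J k (x(k := 0)) = damping J k x" for x by (rule damping_upd)
  have 1: "pmf (cond_pmf ?P {x. x k = n}) x = (c / measure ?P {x. x k = n} * (\<theta> k ^ n / fact n)) * w x" for x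
    by (auto simp: pmf_cond[OF ne] c w_def gibbs_density_insert[OF J] gibbs_density_tilt infl0 power_mult_distrib mult.commute mult.left_commute)
  have supp: "y k = 0" if "y \<in> set_pmf ?R" for y
    using that set_gibbs_law[OF J(1) \<theta>n] J(2) by (auto simp: confs_def)
  have 2: "pmf (map_pmf (\<lambda>y. y(k := n)) ?R) x = c' * w x" for x
  proof (cases "x k = n")
    case True
    have "pmf (map_pmf (\<lambda>y. y(k := n)) ?R) x = measure ?R ((\<lambda>y. y(k := n)) -` {x})" by (rule pmf_map)
    \<comment> \<open>On the support of \<open>?R\<close> the entry at \<open>k\<close> is 0, so the
      only preimage of \<open>x\<close> there is \<open>x(k := 0)\<close>.\<close>
    also have "\<dots> = measure ?R {x(k := 0)}"
      by (intro measure_pmf.finite_measure_eq_AE) (use supp True in \<open>auto simp: AE_measure_pmf_iff fun_eq_iff\<close>)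
    also have "\<dots> = c' * w x" using True by (simp add: measure_pmf_single c' w_def)
    finally show ?thesis .
  next
    case False
    hence "(\<lambda>y. y(k := n)) -` {x} = {}" by (auto simp: fun_eq_iff)
    thus ?thesis using False by (simp add: pmf_map w_def)
  qed
  show ?thesis by (rule pmf_proportional_unique[OF 1 2])
qed

lemma gibbs_law_disintegration:
  assumes "finite J" "k \<notin> J" "\<forall>i\<in>insert k J. 0 \<le> \<theta> i"
  shows "bind_pmf (map_pmf (\<lambda>x. x k) (gibbs_law (insert k J) \<theta>))
           (\<lambda>n. map_pmf (\<lambda>y. y(k := n)) (gibbs_law J (\<lambda>i. \<theta> i * a k i ^ n))) = gibbs_law (insert k J) \<theta>"
proof -
  have "bind_pmf (map_pmf (\<lambda>x. x k) (gibbs_law (insert k J) \<theta>))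
           (\<lambda>n. map_pmf (\<lambda>y. y(k := n)) (gibbs_law J (\<lambda>i. \<theta> i * a k i ^ n)))
      = bind_pmf (map_pmf (\<lambda>x. x k) (gibbs_law (insert k J) \<theta>)) (\<lambda>n. cond_pmf (gibbs_law (insert k J) \<theta>) {x. x k = n})"
    using gibbs_law_cond_site[OF assms] by (intro bind_pmf_cong[OF refl]) simp
  also have "\<dots> = gibbs_law (insert k J) \<theta>" by (rule bind_cond_pmf_fibre)
  finally show ?thesis .
qed

lemma gibbs_law_cond_rest:
  assumes J: "finite J" "k \<notin> J" and \<theta>: "\<forall>i\<in>insert k J. 0 \<le> \<theta> i"
    and y: "y \<in> set_pmf (map_pmf (\<lambda>x. x(k := 0)) (gibbs_law (insert k J) \<theta>))"
  shows "cond_pmf (gibbs_law (insert k J) \<theta>) {x. x(k := 0) = y}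
       = map_pmf (\<lambda>n. y(k := n)) (poisson_law (\<theta> k * damping J k y))"
proof -
  let ?P = "gibbs_law (insert k J) \<theta>" and ?t = "\<theta> k * damping J k y"
  have t: "0 \<le> ?t" using \<theta> damping_bounds by simp
  have ne: "set_pmf ?P \<inter> {x. x(k := 0) = y} \<noteq> {}" using y by auto
  have yk: "y k = 0" using y by auto
  obtain c where c: "\<And>x. pmf ?P x = c * gibbs_density (insert k J) \<theta> x" using pmf_gibbs_law[of "insert k J" \<theta>] J \<theta> by auto
  define w where "w x = (if x(k := 0) = y then ?t ^ x k / fact (x k) else 0)" for x
  have infl0: "damping J k x = damping J k y" if "x(k := 0) = y" for x using damping_upd[of J k x 0] that by simp
  have 1: "pmf (cond_pmf ?P {x. x(k := 0) = y}) x = (c / measure ?P {x. x(k := 0) = y} * gibbs_density J \<theta> y) * w x" for x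
    using infl0[of x] by (simp add: pmf_cond[OF ne] c w_def gibbs_density_insert[OF J])
  have 2: "pmf (map_pmf (\<lambda>n. y(k := n)) (poisson_law ?t)) x = exp (- ?t) * w x" for x
  proof (cases "x(k := 0) = y")
    case True
    hence "y(k := n) = x \<longleftrightarrow> n = x k" for n by (metis fun_upd_same fun_upd_triv fun_upd_upd)
    hence "(\<lambda>n. y(k := n)) -` {x} = {x k}" by auto
    thus ?thesis using True t by (simp add: pmf_map measure_pmf_single w_def pmf_poisson_law)
  next
    case False
    hence "y(k := n) \<noteq> x" for n using yk by (metis fun_upd_triv fun_upd_upd)
    hence "(\<lambda>n. y(k := n)) -` {x} = {}" by auto
    thus ?thesis using False by (simp add: pmf_map w_def)
  qed
  show ?thesis by (rule pmf_proportional_unique[OF 1 2])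
qed

text \<open>Invariance under the heat-bath update of site \<open>k\<close>. Erasing \<open>k\<close>
  and applying the kernel \<open>?K\<close> rebuilds the Gibbs law; as \<open>?K\<close> ignores the
  old value at \<open>k\<close>, applying it once more changes nothing.\<close>

lemma gibbs_law_resample:
  assumes J: "finite J" "k \<in> J" and \<theta>: "\<forall>i\<in>J. 0 \<le> \<theta> i"
  shows "bind_pmf (gibbs_law J \<theta>) (\<lambda>x. map_pmf (\<lambda>v. x(k := v)) (poisson_law (\<theta> k * damping J k x))) = gibbs_law J \<theta>"
proof -
  define J' where "J' = J - {k}"
  have J': "finite J'" "k \<notin> J'" "J = insert k J'" using J by (auto simp: J'_def)
  let ?r = "map_pmf (\<lambda>x. x(k := 0)) (gibbs_law J \<theta>)"
  let ?K = "\<lambda>x. map_pmf (\<lambda>v. x(k := v)) (poisson_law (\<theta> k * damping J k x))"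
  have damping: "damping J k x = damping J' k x" for x using J' by (simp add: damping_insert)
  have "gibbs_law J \<theta> = bind_pmf ?r (\<lambda>y. cond_pmf (gibbs_law J \<theta>) {x. x(k := 0) = y})"
    by (rule bind_cond_pmf_fibre[symmetric])
  also have "\<dots> = bind_pmf ?r ?K"
    unfolding damping using gibbs_law_cond_rest[OF J'(1,2), of \<theta>] \<theta> J'(3)
    by (intro bind_pmf_cong[OF refl]) simp
  finally have dis: "gibbs_law J \<theta> = bind_pmf ?r ?K" .
  have "bind_pmf (?K y) ?K = ?K y" for y
  proof -
    have "?K (y(k := v)) = ?K y" for v unfolding damping_upd fun_upd_upd ..
    thus ?thesis unfolding bind_map_pmf by (simp only: bind_pmf_const)
  qed
  hence "bind_pmf (bind_pmf ?r ?K) ?K = bind_pmf ?r ?K"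
    unfolding bind_assoc_pmf by presburger
  thus ?thesis using dis by simp
qed

lemma gibbs_law_marginal:
  assumes "finite J" "k \<in> J" "\<forall>i\<in>J. 0 \<le> \<theta> i"
  shows "map_pmf (\<lambda>x. x k) (gibbs_law J \<theta>) = bind_pmf (gibbs_law J \<theta>) (\<lambda>x. poisson_law (\<theta> k * damping J k x))"
proof -
  have "map_pmf (\<lambda>x. x k) (gibbs_law J \<theta>)
     = map_pmf (\<lambda>x. x k) (bind_pmf (gibbs_law J \<theta>) (\<lambda>x. map_pmf (\<lambda>v. x(k := v)) (poisson_law (\<theta> k * damping J k x))))"
    using gibbs_law_resample[OF assms] by simp
  also have "\<dots> = bind_pmf (gibbs_law J \<theta>) (\<lambda>x. poisson_law (\<theta> k * damping J k x))"
    by (simp add: map_bind_pmf map_pmf_comp)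
  finally show ?thesis .
qed

lemma gibbs_law_mean:
  assumes "finite J" "k \<in> J" "\<forall>i\<in>J. 0 \<le> \<theta> i"
  shows "(\<integral>\<^sup>+x. ennreal (real (x k)) \<partial>measure_pmf (gibbs_law J \<theta>)) \<le> ennreal (\<theta> k)"
proof -
  have t: "0 \<le> \<theta> k * damping J k x" for x using assms damping_bounds by simp
  have "(\<integral>\<^sup>+x. ennreal (real (x k)) \<partial>measure_pmf (gibbs_law J \<theta>))
      = (\<integral>\<^sup>+n. ennreal (real n) \<partial>measure_pmf (map_pmf (\<lambda>x. x k) (gibbs_law J \<theta>)))" by simp
  also have "\<dots> = (\<integral>\<^sup>+x. ennreal (\<theta> k * damping J k x) \<partial>measure_pmf (gibbs_law J \<theta>))"
    unfolding gibbs_law_marginal[OF assms] nn_integral_bind_pmf using t by (simp only: nn_integral_poisson_law_mean)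
  also have "\<dots> \<le> (\<integral>\<^sup>+x. ennreal (\<theta> k) \<partial>measure_pmf (gibbs_law J \<theta>))"
    using assms damping_bounds by (intro nn_integral_mono ennreal_leI) (simp add: mult_left_le)
  also have "\<dots> = ennreal (\<theta> k)" by simp
  finally show ?thesis .
qed

end

section \<open>Dobrushin comparison of Gibbs measures\<close>

definition site_dist :: "nat set \<Rightarrow> (nat \<Rightarrow> nat) \<Rightarrow> (nat \<Rightarrow> nat) \<Rightarrow> real" where
  "site_dist J x y = (\<Sum>i\<in>J. nat_dist (x i) (y i))"

lemma site_dist_nonneg: "0 \<le> site_dist J x y"
  by (simp add: site_dist_def sum_nonneg)

lemma site_dist_triangle: "site_dist J x z \<le> site_dist J x y + site_dist J y z"
  unfolding site_dist_def sum.distrib[symmetric] by (intro sum_mono) auto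

lemma abs_power_diff_le:
  fixes b :: real
  assumes "0 \<le> b" "b \<le> 1"
  shows "\<bar>b ^ m - b ^ n\<bar> \<le> (1 - b) * nat_dist m n"
proof -
  have *: "\<bar>b ^ m - b ^ (m + k)\<bar> \<le> (1 - b) * real k" for m k
  proof (induction k)
    case (Suc k)
    have "b ^ (m + k) - b ^ (m + Suc k) = b ^ (m + k) * (1 - b)"
      by (simp add: algebra_simps)
    hence "\<bar>b ^ (m + k) - b ^ (m + Suc k)\<bar> = b ^ (m + k) * (1 - b)"
      using assms by simp
    also have "\<dots> \<le> 1 - b"
      using assms by (intro mult_left_le_one_le) (auto intro: power_le_one)
    finally show ?case using Suc by (simp add: algebra_simps)
  qed simp
  show ?thesis
  proof (cases "m \<le> n")
    case True
    thus ?thesis using *[of m "n - m"] by (simp add: of_nat_diff)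
  next
    case False
    thus ?thesis using *[of n "m - n"] by (simp add: of_nat_diff abs_minus_commute)
  qed
qed

context interaction
begin

text \<open>All factors lie in [0,1], so the difference of the products is at most the sum of the
  differences of the factors, and one unit at \<open>j\<close> changes its factor by at most
  \<open>1 - a i j\<close>.\<close>

lemma damping_diff_le: "\<bar>damping J i x - damping J i y\<bar> \<le> (\<Sum>j\<in>J. (1 - a i j) * nat_dist (x j) (y j))"
proof -
  have "\<bar>damping J i x - damping J i y\<bar> \<le> (\<Sum>j\<in>J. \<bar>a i j ^ x j - a i j ^ y j\<bar>)"
    unfolding damping_def using norm_prod_diff[of J "\<lambda>j. a i j ^ x j" "\<lambda>j. a i j ^ y j"]
    by (simp add: a_nonneg a_le_1 power_le_one)
  also have "\<dots> \<le> (\<Sum>j\<in>J. (1 - a i j) * nat_dist (x j) (y j))"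
    by (intro sum_mono abs_power_diff_le a_nonneg a_le_1)
  finally show ?thesis .
qed

text \<open>The change splits into a change of configuration at intensities \<open>\<theta>\<close>
  and a change of intensities at a fixed configuration. In the first part, summing over the updated
  site \<open>i\<close> leaves for each \<open>j\<close> exactly the column sum that Dobrushin's
  condition bounds.\<close>

lemma intensity_diff_le:
  assumes J: "finite J" and \<theta>: "\<forall>i\<in>J. 0 \<le> \<theta> i"
    and D: "\<forall>j\<in>J. (\<Sum>i\<in>J. \<theta> i * (1 - a i j)) \<le> D"
  shows "(\<Sum>i\<in>J. \<bar>\<theta> i * damping J i x - \<theta>' i * damping J i y\<bar>) \<le> D * site_dist J x y + (\<Sum>i\<in>J. \<bar>\<theta> i - \<theta>' i\<bar>)"
proof -
  have "(\<Sum>i\<in>J. \<bar>\<theta> i * damping J i x - \<theta>' i * damping J i y\<bar>)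
     \<le> (\<Sum>i\<in>J. (\<Sum>j\<in>J. \<theta> i * (1 - a i j) * nat_dist (x j) (y j)) + \<bar>\<theta> i - \<theta>' i\<bar>)"
  proof (intro sum_mono)
    fix i assume i: "i \<in> J"
    have "\<theta> i * damping J i x - \<theta>' i * damping J i y = \<theta> i * (damping J i x - damping J i y) + (\<theta> i - \<theta>' i) * damping J i y"
      by (simp add: algebra_simps)
    hence "\<bar>\<theta> i * damping J i x - \<theta>' i * damping J i y\<bar> \<le> \<theta> i * \<bar>damping J i x - damping J i y\<bar> + \<bar>\<theta> i - \<theta>' i\<bar> * damping J i y"
      using \<theta> i damping_bounds(1)[of J i y]
        abs_triangle_ineq[of "\<theta> i * (damping J i x - damping J i y)" "(\<theta> i - \<theta>' i) * damping J i y"]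
      by (simp add: abs_mult)
    also have "\<dots> \<le> \<theta> i * (\<Sum>j\<in>J. (1 - a i j) * nat_dist (x j) (y j)) + \<bar>\<theta> i - \<theta>' i\<bar>"
      using \<theta> i damping_bounds[of J i y] by (intro add_mono mult_left_mono damping_diff_le mult_left_le) auto
    finally show "\<bar>\<theta> i * damping J i x - \<theta>' i * damping J i y\<bar>
       \<le> (\<Sum>j\<in>J. \<theta> i * (1 - a i j) * nat_dist (x j) (y j)) + \<bar>\<theta> i - \<theta>' i\<bar>"
      by (simp add: sum_distrib_left mult.assoc)
  qed
  also have "\<dots> = (\<Sum>j\<in>J. (\<Sum>i\<in>J. \<theta> i * (1 - a i j)) * nat_dist (x j) (y j)) + (\<Sum>i\<in>J. \<bar>\<theta> i - \<theta>' i\<bar>)"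
    by (simp add: sum.distrib sum_distrib_right) (rule sum.swap)
  also have "\<dots> \<le> (\<Sum>j\<in>J. D * nat_dist (x j) (y j)) + (\<Sum>i\<in>J. \<bar>\<theta> i - \<theta>' i\<bar>)"
    using D by (intro add_mono sum_mono mult_right_mono) auto
  finally show ?thesis by (simp add: site_dist_def sum_distrib_left)
qed

text \<open>Update site \<open>k\<close> in both coordinates with Poisson variables coupled as in
  \<open>poisson_law_coupling\<close>. Both Gibbs measures are invariant under their own update, so
  the result is again a coupling of them and costs at least the infimum, while only the discrepancy
  at \<open>k\<close> has changed. The old discrepancy stands on the left so that nothing is
  subtracted in \<open>ennreal\<close>.\<close>

lemma resample_coupling:
  assumes J: "finite J" "k \<in> J" and \<theta>: "\<forall>i\<in>J. 0 \<le> \<theta> i" and \<theta>': "\<forall>i\<in>J. 0 \<le> \<theta>' i"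
    and \<pi>: "\<pi> \<in> couplings (gibbs_law J \<theta>) (gibbs_law J \<theta>')"
  shows "wasserstein1 (site_dist J) (gibbs_law J \<theta>) (gibbs_law J \<theta>') + (\<integral>\<^sup>+z. ennreal (nat_dist (fst z k) (snd z k)) \<partial>measure_pmf \<pi>)
    \<le> transport_cost (site_dist J) \<pi> + (\<integral>\<^sup>+z. ennreal \<bar>\<theta> k * damping J k (fst z) - \<theta>' k * damping J k (snd z)\<bar> \<partial>measure_pmf \<pi>)"
proof -
  let ?s = "\<lambda>x. \<theta> k * damping J k x" and ?s' = "\<lambda>y. \<theta>' k * damping J k y"
  have s: "0 \<le> ?s x" "0 \<le> ?s' x" for x using \<theta> \<theta>' J damping_bounds by auto
  have "\<forall>z. \<exists>\<rho>. \<rho> \<in> couplings (poisson_law (?s (fst z))) (poisson_law (?s' (snd z))) \<and>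
        transport_cost nat_dist \<rho> \<le> ennreal \<bar>?s (fst z) - ?s' (snd z)\<bar>"
    using poisson_law_coupling[OF s] by (simp add: Bex_def)
  from choice[OF this] obtain K where K: "\<And>z. K z \<in> couplings (poisson_law (?s (fst z))) (poisson_law (?s' (snd z)))"
      "\<And>z. transport_cost nat_dist (K z) \<le> ennreal \<bar>?s (fst z) - ?s' (snd z)\<bar>" by blast
  define L where "L z = map_pmf (\<lambda>u. ((fst z)(k := fst u), (snd z)(k := snd u))) (K z)" for z
  have "bind_pmf \<pi> L \<in> couplings (bind_pmf (gibbs_law J \<theta>) (\<lambda>x. map_pmf (\<lambda>v. x(k := v)) (poisson_law (?s x))))
     (bind_pmf (gibbs_law J \<theta>') (\<lambda>y. map_pmf (\<lambda>v. y(k := v)) (poisson_law (?s' y))))"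
  proof (rule bind_pmf_couplings[OF \<pi>])
    fix x y
    have "map_pmf fst (L (x, y)) = map_pmf (\<lambda>v. x(k := v)) (map_pmf fst (K (x, y)))"
      "map_pmf snd (L (x, y)) = map_pmf (\<lambda>v. y(k := v)) (map_pmf snd (K (x, y)))"
      by (simp_all add: L_def map_pmf_comp)
    thus "L (x, y) \<in> couplings (map_pmf (\<lambda>v. x(k := v)) (poisson_law (?s x))) (map_pmf (\<lambda>v. y(k := v)) (poisson_law (?s' y)))"
      using K(1)[of "(x, y)"] by (simp add: couplings_def)
  qed
  hence "bind_pmf \<pi> L \<in> couplings (gibbs_law J \<theta>) (gibbs_law J \<theta>')"
    by (simp only: gibbs_law_resample[OF J \<theta>] gibbs_law_resample[OF J \<theta>'])
  hence W: "wasserstein1 (site_dist J) (gibbs_law J \<theta>) (gibbs_law J \<theta>') \<le> transport_cost (site_dist J) (bind_pmf \<pi> L)"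
    by (rule wasserstein1_le)
  have hd: "site_dist J x y = nat_dist (x k) (y k) + site_dist (J - {k}) x y" for x y
    unfolding site_dist_def by (rule sum.remove) (use J in auto)
  have hdu: "site_dist (J - {k}) (x(k := u)) (y(k := v)) = site_dist (J - {k}) x y" for x y u v
    unfolding site_dist_def by (intro sum.cong) auto
  have "transport_cost (site_dist J) (bind_pmf \<pi> L)
     = (\<integral>\<^sup>+z. (\<integral>\<^sup>+u. ennreal (nat_dist (fst u) (snd u)) + ennreal (site_dist (J - {k}) (fst z) (snd z)) \<partial>measure_pmf (K z)) \<partial>measure_pmf \<pi>)"
    by (simp add: L_def hd hdu site_dist_nonneg ennreal_plus)
  also have "\<dots> = (\<integral>\<^sup>+z. transport_cost nat_dist (K z) + ennreal (site_dist (J - {k}) (fst z) (snd z)) \<partial>measure_pmf \<pi>)"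
    by (subst nn_integral_add) simp_all
  also have "\<dots> \<le> (\<integral>\<^sup>+z. ennreal \<bar>?s (fst z) - ?s' (snd z)\<bar> + ennreal (site_dist (J - {k}) (fst z) (snd z)) \<partial>measure_pmf \<pi>)"
    by (intro nn_integral_mono add_mono K(2)) simp
  finally have "wasserstein1 (site_dist J) (gibbs_law J \<theta>) (gibbs_law J \<theta>')
     \<le> (\<integral>\<^sup>+z. ennreal \<bar>?s (fst z) - ?s' (snd z)\<bar> \<partial>measure_pmf \<pi>)
      + (\<integral>\<^sup>+z. ennreal (site_dist (J - {k}) (fst z) (snd z)) \<partial>measure_pmf \<pi>)"
    using W by (simp add: nn_integral_add)
  hence "wasserstein1 (site_dist J) (gibbs_law J \<theta>) (gibbs_law J \<theta>') + (\<integral>\<^sup>+z. ennreal (nat_dist (fst z k) (snd z k)) \<partial>measure_pmf \<pi>)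
     \<le> (\<integral>\<^sup>+z. ennreal \<bar>?s (fst z) - ?s' (snd z)\<bar> \<partial>measure_pmf \<pi>)
      + (\<integral>\<^sup>+z. ennreal (site_dist (J - {k}) (fst z) (snd z)) \<partial>measure_pmf \<pi>)
      + (\<integral>\<^sup>+z. ennreal (nat_dist (fst z k) (snd z k)) \<partial>measure_pmf \<pi>)"
    by (rule add_right_mono)
  also have "\<dots> = transport_cost (site_dist J) \<pi> + (\<integral>\<^sup>+z. ennreal \<bar>?s (fst z) - ?s' (snd z)\<bar> \<partial>measure_pmf \<pi>)"
    by (simp add: hd[of "fst z" "snd z" for z] site_dist_nonneg ennreal_plus nn_integral_add ac_simps)
  finally show ?thesis .
qed

text \<open>The comparison cancels the transport cost from both sides and so must know it to be
  finite. The independent coupling suffices, since the site means are at most the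
  intensities.\<close>

lemma gibbs_law_transport_finite:
  assumes J: "finite J" and \<theta>: "\<forall>i\<in>J. 0 \<le> \<theta> i" and \<theta>': "\<forall>i\<in>J. 0 \<le> \<theta>' i"
  shows "wasserstein1 (site_dist J) (gibbs_law J \<theta>) (gibbs_law J \<theta>') < top"
proof -
  let ?\<pi> = "pair_pmf (gibbs_law J \<theta>) (gibbs_law J \<theta>')"
  have "?\<pi> \<in> couplings (gibbs_law J \<theta>) (gibbs_law J \<theta>')"
    by (simp add: couplings_def map_fst_pair_pmf map_snd_pair_pmf)
  hence "wasserstein1 (site_dist J) (gibbs_law J \<theta>) (gibbs_law J \<theta>') \<le> transport_cost (site_dist J) ?\<pi>" by (rule wasserstein1_le)
  also have "\<dots> \<le> (\<integral>\<^sup>+z. (\<Sum>i\<in>J. ennreal (real (fst z i)) + ennreal (real (snd z i))) \<partial>measure_pmf ?\<pi>)"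
  proof (intro nn_integral_mono)
    fix z :: "(nat \<Rightarrow> nat) \<times> (nat \<Rightarrow> nat)"
    have "site_dist J (fst z) (snd z) \<le> (\<Sum>i\<in>J. real (fst z i) + real (snd z i))"
      unfolding site_dist_def by (intro sum_mono) auto
    hence "ennreal (site_dist J (fst z) (snd z)) \<le> ennreal (\<Sum>i\<in>J. real (fst z i) + real (snd z i))"
      by (rule ennreal_leI)
    thus "ennreal (site_dist J (fst z) (snd z)) \<le> (\<Sum>i\<in>J. ennreal (real (fst z i)) + ennreal (real (snd z i)))"
      by (subst (asm) sum_ennreal[symmetric]) (auto simp: ennreal_plus)
  qed
  also have "\<dots> = (\<Sum>i\<in>J. (\<integral>\<^sup>+x. ennreal (real (x i)) \<partial>measure_pmf (map_pmf fst ?\<pi>))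
      + (\<integral>\<^sup>+x. ennreal (real (x i)) \<partial>measure_pmf (map_pmf snd ?\<pi>)))"
    by (subst nn_integral_sum) (simp_all add: nn_integral_add del: map_fst_pair_pmf map_snd_pair_pmf)
  also have "\<dots> \<le> (\<Sum>i\<in>J. ennreal (\<theta> i) + ennreal (\<theta>' i))"
    unfolding map_fst_pair_pmf map_snd_pair_pmf
    by (intro sum_mono add_mono gibbs_law_mean assms)
  also have "\<dots> < top" using J by (simp add: ennreal_add_less_top)
  finally show ?thesis .
qed

text \<open>Adding the resampling inequalities over the \<open>n\<close> sites gives
  \<open>n * w + c \<le> n * c + (D * c + b)\<close> for every coupling of finite cost
  \<open>c\<close>. For \<open>c\<close> close to the infimum \<open>w\<close> this becomes
  \<open>(1 - D) * w \<le> b\<close>.\<close>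

lemma gibbs_law_comparison:
  assumes J: "finite J" and \<theta>: "\<forall>i\<in>J. 0 \<le> \<theta> i" and \<theta>': "\<forall>i\<in>J. 0 \<le> \<theta>' i"
    and D: "\<forall>j\<in>J. (\<Sum>i\<in>J. \<theta> i * (1 - a i j)) \<le> D" "0 \<le> D" "D < 1"
  shows "ennreal (1 - D) * wasserstein1 (site_dist J) (gibbs_law J \<theta>) (gibbs_law J \<theta>') \<le> ennreal (\<Sum>i\<in>J. \<bar>\<theta> i - \<theta>' i\<bar>)"
proof (cases "J = {}")
  case True
  have "pair_pmf (gibbs_law J \<theta>) (gibbs_law J \<theta>') \<in> couplings (gibbs_law J \<theta>) (gibbs_law J \<theta>')"
    by (simp add: couplings_def map_fst_pair_pmf map_snd_pair_pmf)
  from wasserstein1_le[OF this, of "site_dist J"] show ?thesis using True by (simp add: site_dist_def)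
next
  case False
  let ?W = "wasserstein1 (site_dist J) (gibbs_law J \<theta>) (gibbs_law J \<theta>')"
  define n where "n = real (card J)"
  have n: "1 \<le> n" using False J by (simp add: n_def Suc_leI card_gt_0_iff)
  define b where "b = (\<Sum>i\<in>J. \<bar>\<theta> i - \<theta>' i\<bar>)"
  have b: "0 \<le> b" by (simp add: b_def sum_nonneg)
  obtain w where w: "?W = ennreal w" "0 \<le> w"
    using gibbs_law_transport_finite[OF J \<theta> \<theta>'] by (cases ?W) auto
  have key: "n * w + c \<le> n * c + (D * c + b)" if \<pi>: "\<pi> \<in> couplings (gibbs_law J \<theta>) (gibbs_law J \<theta>')"
    and c: "transport_cost (site_dist J) \<pi> = ennreal c" "0 \<le> c" for \<pi> c
  proof -
    have sumc: "(\<Sum>k\<in>J. \<integral>\<^sup>+z. ennreal (nat_dist (fst z k) (snd z k)) \<partial>measure_pmf \<pi>) = ennreal c"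
      by (subst nn_integral_sum[symmetric]) (simp_all add: c(1)[symmetric] site_dist_def)
    have "ennreal (n * w + c) = (\<Sum>k\<in>J. ?W + (\<integral>\<^sup>+z. ennreal (nat_dist (fst z k) (snd z k)) \<partial>measure_pmf \<pi>))"
      using w c n by (simp add: sum.distrib sumc n_def ennreal_mult ennreal_of_nat_eq_real_of_nat ennreal_plus)
    also have "\<dots> \<le> (\<Sum>k\<in>J. transport_cost (site_dist J) \<pi> +
        (\<integral>\<^sup>+z. ennreal \<bar>\<theta> k * damping J k (fst z) - \<theta>' k * damping J k (snd z)\<bar> \<partial>measure_pmf \<pi>))"
      by (intro sum_mono resample_coupling J \<theta> \<theta>' \<pi>)
    also have "\<dots> = ennreal (n * c) +
        (\<integral>\<^sup>+z. (\<Sum>k\<in>J. ennreal \<bar>\<theta> k * damping J k (fst z) - \<theta>' k * damping J k (snd z)\<bar>) \<partial>measure_pmf \<pi>)"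
      using c n by (subst nn_integral_sum)
        (simp_all add: sum.distrib n_def ennreal_mult ennreal_of_nat_eq_real_of_nat)
    also have "\<dots> \<le> ennreal (n * c) + (\<integral>\<^sup>+z. ennreal D * ennreal (site_dist J (fst z) (snd z)) + ennreal b \<partial>measure_pmf \<pi>)"
    proof (intro add_left_mono nn_integral_mono)
      fix z
      have "(\<Sum>k\<in>J. ennreal \<bar>\<theta> k * damping J k (fst z) - \<theta>' k * damping J k (snd z)\<bar>)
         = ennreal (\<Sum>k\<in>J. \<bar>\<theta> k * damping J k (fst z) - \<theta>' k * damping J k (snd z)\<bar>)" by (simp add: sum_ennreal)
      also have "\<dots> \<le> ennreal (D * site_dist J (fst z) (snd z) + b)"
        unfolding b_def by (intro ennreal_leI intensity_diff_le[OF J \<theta> D(1)])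
      also have "\<dots> = ennreal D * ennreal (site_dist J (fst z) (snd z)) + ennreal b"
        using D b site_dist_nonneg by (simp add: ennreal_plus ennreal_mult)
      finally show "(\<Sum>k\<in>J. ennreal \<bar>\<theta> k * damping J k (fst z) - \<theta>' k * damping J k (snd z)\<bar>)
         \<le> ennreal D * ennreal (site_dist J (fst z) (snd z)) + ennreal b" .
    qed
    also have "\<dots> = ennreal (n * c + (D * c + b))"
      using c n D b by (simp add: nn_integral_add nn_integral_cmult ennreal_plus ennreal_mult)
    finally show ?thesis using n c D b by (subst (asm) ennreal_le_iff) auto
  qed
  have "(1 - D) * w \<le> b"
  proof (rule field_le_epsilon)
    fix e :: real assume e: "0 < e"
    \<comment> \<open>The slack will be multiplied by \<open>n - 1 + D\<close>, which lies between 0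
      and \<open>n\<close>; a slack of \<open>e / n\<close> therefore costs at most
      \<open>e\<close>.\<close>
    hence "0 < e / n" using n by simp
    then obtain \<pi> where \<pi>: "\<pi> \<in> couplings (gibbs_law J \<theta>) (gibbs_law J \<theta>')" "transport_cost (site_dist J) \<pi> \<le> ?W + ennreal (e / n)"
      using wasserstein1_near_optimal[of "e / n"] gibbs_law_transport_finite[OF J \<theta> \<theta>'] by blast
    have "?W + ennreal (e / n) = ennreal (w + e / n)" using w e n by (simp add: ennreal_plus)
    with \<pi>(2) have le: "transport_cost (site_dist J) \<pi> \<le> ennreal (w + e / n)" by simp
    then obtain c where c: "transport_cost (site_dist J) \<pi> = ennreal c" "0 \<le> c"
      by (cases "transport_cost (site_dist J) \<pi>") (auto simp: top_unique)
    have c3: "c \<le> w + e / n" using le w e n unfolding c(1) by (subst (asm) ennreal_le_iff) auto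
    have "n * w \<le> (n - 1 + D) * c + b" using key[OF \<pi>(1) c] by (simp add: algebra_simps)
    also have "\<dots> \<le> (n - 1 + D) * (w + e / n) + b"
      using c3 n D by (intro add_right_mono mult_left_mono) auto
    finally have "(1 - D) * w \<le> b + (n - 1 + D) * (e / n)" by (simp add: algebra_simps)
    also have "(n - 1 + D) * (e / n) \<le> n * (e / n)" using n D e by (intro mult_right_mono) auto
    finally show "(1 - D) * w \<le> b + e" using n by simp
  qed
  thus ?thesis using w D by (simp add: b_def ennreal_leI flip: ennreal_mult)
qed

end

section \<open>The transport inequality by induction over the sites\<close>

text \<open>A map that \<open>r\<close> undoes on both supports loses no information, so test
  functions are carried over by composing with \<open>r\<close>. This puts a frozen site back into
  the configuration.\<close>

lemma entropy_dual_map_pmf: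
  assumes r: "\<And>x. x \<in> set_pmf q \<union> set_pmf p \<Longrightarrow> r (f x) = x"
  shows "entropy_dual q p \<kappa> \<le> entropy_dual (map_pmf f q) (map_pmf f p) \<kappa>"
  unfolding entropy_dual_def[of q]
proof (rule SUP_least)
  fix G assume G: "G \<in> entropy_admissible q p \<kappa>"
  obtain B where B: "\<And>x. \<bar>G x\<bar> \<le> B" using entropy_admissibleD(1)[OF G] by blast
  have 1: "measure_pmf.expectation (map_pmf f q) (\<lambda>x. G (r x)) = measure_pmf.expectation q G"
    unfolding integral_map_pmf by (intro integral_cong_AE) (use r in \<open>auto simp: AE_measure_pmf_iff\<close>)
  have 2: "measure_pmf.expectation (map_pmf f p) (\<lambda>x. exp (G (r x))) = measure_pmf.expectation p (\<lambda>x. exp (G x))"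
    unfolding integral_map_pmf by (intro integral_cong_AE) (use r in \<open>auto simp: AE_measure_pmf_iff\<close>)
  show "ennreal (measure_pmf.expectation q G) \<le> entropy_dual (map_pmf f q) (map_pmf f p) \<kappa>"
    using le_entropy_dual[of "\<lambda>x. G (r x)" B "map_pmf f p" \<kappa> "map_pmf f q"] B entropy_admissibleD(2)[OF G] 1 2 by simp
qed

lemma le_wasserstein1_add:
  assumes "\<And>\<pi>. \<pi> \<in> couplings \<mu> \<nu> \<Longrightarrow> X \<le> transport_cost d \<pi> + c"
  shows "X \<le> wasserstein1 d \<mu> \<nu> + c"
proof (rule ennreal_le_epsilon)
  fix e :: real assume "0 < e" "wasserstein1 d \<mu> \<nu> + c < top"
  hence "wasserstein1 d \<mu> \<nu> < top" by (simp add: ennreal_add_less_top)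
  then obtain \<pi> where \<pi>: "\<pi> \<in> couplings \<mu> \<nu>" "transport_cost d \<pi> \<le> wasserstein1 d \<mu> \<nu> + ennreal e"
    using wasserstein1_near_optimal[OF \<open>0 < e\<close>] by blast
  have "X \<le> transport_cost d \<pi> + c" by (rule assms[OF \<pi>(1)])
  also have "\<dots> \<le> (wasserstein1 d \<mu> \<nu> + ennreal e) + c" by (rule add_right_mono[OF \<pi>(2)])
  finally show "X \<le> wasserstein1 d \<mu> \<nu> + c + ennreal e" by (simp add: ac_simps)
qed

lemma wasserstein1_site_dist_insert:
  assumes J: "finite J" "k \<notin> J"
  shows "wasserstein1 (site_dist (insert k J)) (map_pmf (\<lambda>y. y(k := n)) \<mu>) (map_pmf (\<lambda>y. y(k := m)) \<nu>)
     \<le> ennreal (nat_dist n m) + wasserstein1 (site_dist J) \<mu> \<nu>"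
proof -
  have "wasserstein1 (site_dist (insert k J)) (map_pmf (\<lambda>y. y(k := n)) \<mu>) (map_pmf (\<lambda>y. y(k := m)) \<nu>)
     \<le> wasserstein1 (site_dist J) \<mu> \<nu> + ennreal (nat_dist n m)"
  proof (rule le_wasserstein1_add)
    fix \<pi> assume \<pi>: "\<pi> \<in> couplings \<mu> \<nu>"
    let ?\<rho> = "map_pmf (\<lambda>z. ((fst z)(k := n), (snd z)(k := m))) \<pi>"
    have "map_pmf fst ?\<rho> = map_pmf (\<lambda>y. y(k := n)) (map_pmf fst \<pi>)"
      "map_pmf snd ?\<rho> = map_pmf (\<lambda>y. y(k := m)) (map_pmf snd \<pi>)" by (simp_all add: map_pmf_comp)
    hence "?\<rho> \<in> couplings (map_pmf (\<lambda>y. y(k := n)) \<mu>) (map_pmf (\<lambda>y. y(k := m)) \<nu>)"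
      using \<pi> by (simp add: couplings_def)
    hence "wasserstein1 (site_dist (insert k J)) (map_pmf (\<lambda>y. y(k := n)) \<mu>) (map_pmf (\<lambda>y. y(k := m)) \<nu>)
      \<le> transport_cost (site_dist (insert k J)) ?\<rho>" by (rule wasserstein1_le)
    also have "\<dots> = (\<integral>\<^sup>+z. ennreal (site_dist J (fst z) (snd z)) + ennreal (nat_dist n m) \<partial>measure_pmf \<pi>)"
    proof -
      have "site_dist (insert k J) (x(k := n)) (y(k := m)) = site_dist J x y + nat_dist n m" for x y
      proof -
        have "(\<Sum>i\<in>J. nat_dist ((x(k := n)) i) ((y(k := m)) i)) = site_dist J x y"
          unfolding site_dist_def using J by (intro sum.cong) auto
        thus ?thesis using J by (simp add: site_dist_def)
      qed
      thus ?thesis by (simp add: ennreal_plus site_dist_nonneg)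
    qed
    also have "\<dots> = transport_cost (site_dist J) \<pi> + ennreal (nat_dist n m)" by (simp add: nn_integral_add)
    finally show "wasserstein1 (site_dist (insert k J)) (map_pmf (\<lambda>y. y(k := n)) \<mu>) (map_pmf (\<lambda>y. y(k := m)) \<nu>)
      \<le> transport_cost (site_dist J) \<pi> + ennreal (nat_dist n m)" .
  qed
  thus ?thesis by (simp add: add.commute)
qed

context interaction
begin

lemma gibbs_law_site_lipschitz:
  assumes J: "finite J" "k \<notin> J" and \<theta>: "\<forall>i\<in>insert k J. 0 \<le> \<theta> i"
    and D: "\<forall>j\<in>insert k J. (\<Sum>i\<in>insert k J. \<theta> i * (1 - a i j)) \<le> D" "0 \<le> D" "D < 1"
  shows "ennreal (1 - D) * wasserstein1 (site_dist J) (gibbs_law J (\<lambda>i. \<theta> i * a k i ^ n)) (gibbs_law J (\<lambda>i. \<theta> i * a k i ^ m))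
     \<le> ennreal (D * nat_dist n m)"
proof -
  have pw: "a k i ^ n \<le> 1" "0 \<le> a k i ^ n" for i n
    by (simp_all add: a_nonneg a_le_1 power_le_one)
  have "\<theta> i * a k i ^ n * (1 - a i j) \<le> \<theta> i * (1 - a i j)" if "i \<in> J" for i j
    using that \<theta> pw[of i n] a_le_1[of i j] by (intro mult_right_mono mult_left_le) auto
  hence "(\<Sum>i\<in>J. \<theta> i * a k i ^ n * (1 - a i j)) \<le> (\<Sum>i\<in>J. \<theta> i * (1 - a i j))" for j
    by (intro sum_mono) auto
  moreover have sub: "(\<Sum>i\<in>J. \<theta> i * (1 - a i j)) \<le> (\<Sum>i\<in>insert k J. \<theta> i * (1 - a i j))" for j
    using J \<theta> a_le_1 by simp
  ultimately have D': "\<forall>j\<in>J. (\<Sum>i\<in>J. \<theta> i * a k i ^ n * (1 - a i j)) \<le> D"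
    using D(1) by (meson insertI2 order_trans)
  have "ennreal (1 - D) * wasserstein1 (site_dist J) (gibbs_law J (\<lambda>i. \<theta> i * a k i ^ n)) (gibbs_law J (\<lambda>i. \<theta> i * a k i ^ m))
     \<le> ennreal (\<Sum>i\<in>J. \<bar>\<theta> i * a k i ^ n - \<theta> i * a k i ^ m\<bar>)"
    by (rule gibbs_law_comparison[OF J(1) _ _ D' D(2,3)]) (use \<theta> pw in auto)
  also have "\<dots> \<le> ennreal (D * nat_dist n m)"
  proof (rule ennreal_leI)
    \<comment> \<open>Freezing \<open>k\<close> weights the site \<open>i\<close> by powers of
      \<open>a k i\<close>, whereas Dobrushin's sum at \<open>k\<close> involves
      \<open>a i k\<close>; symmetry joins the two.\<close>
    have "(\<Sum>i\<in>J. \<bar>\<theta> i * a k i ^ n - \<theta> i * a k i ^ m\<bar>) \<le> (\<Sum>i\<in>J. \<theta> i * (1 - a i k) * nat_dist n m)"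
    proof (rule sum_mono)
      fix i assume "i \<in> J"
      have "\<bar>\<theta> i * a k i ^ n - \<theta> i * a k i ^ m\<bar> = \<theta> i * \<bar>a k i ^ n - a k i ^ m\<bar>"
        using \<theta> \<open>i \<in> J\<close> by (simp add: abs_mult flip: right_diff_distrib)
      also have "\<dots> \<le> \<theta> i * ((1 - a k i) * nat_dist n m)"
        using \<theta> \<open>i \<in> J\<close> by (intro mult_left_mono abs_power_diff_le a_nonneg a_le_1) auto
      finally show "\<bar>\<theta> i * a k i ^ n - \<theta> i * a k i ^ m\<bar> \<le> \<theta> i * (1 - a i k) * nat_dist n m"
        by (simp add: a_sym[of k] mult.assoc)
    qed
    also have "\<dots> = (\<Sum>i\<in>J. \<theta> i * (1 - a i k)) * nat_dist n m" by (simp add: sum_distrib_right)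
    also have "\<dots> \<le> D * nat_dist n m" using sub[of k] D(1) by (intro mult_right_mono) (auto intro: order_trans)
    finally show "(\<Sum>i\<in>J. \<bar>\<theta> i * a k i ^ n - \<theta> i * a k i ^ m\<bar>) \<le> D * nat_dist n m" .
  qed
  finally show ?thesis .
qed

text \<open>Intensities and \<open>Q\<close> vary in the induction because freezing site
  \<open>k\<close> at \<open>n\<close> replaces both: the intensities become
  \<open>\<theta> i * a k i ^ n\<close>, and \<open>Q\<close> becomes its conditional law.
  \<open>D\<close> and \<open>l\<close> stay fixed, as the new intensities are no larger.\<close>

lemma gibbs_law_transport_entropy_dual:
  assumes "finite J" "\<forall>i\<in>J. 0 \<le> \<theta> i" "\<forall>j\<in>J. (\<Sum>i\<in>J. \<theta> i * (1 - a i j)) \<le> D" "0 \<le> D" "D < 1" "0 \<le> l"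
    "set_pmf Q \<subseteq> confs J"
  shows "ennreal l * (ennreal (1 - D) * wasserstein1 (site_dist J) Q (gibbs_law J \<theta>))
     \<le> entropy_dual Q (gibbs_law J \<theta>) ((\<Sum>i\<in>J. \<theta> i + (\<theta> i)\<^sup>2 / 4) * phi l)"
  using assms
proof (induction J arbitrary: \<theta> Q rule: finite_induct)
  case empty
  have "pair_pmf Q (gibbs_law {} \<theta>) \<in> couplings Q (gibbs_law {} \<theta>)"
    by (simp add: couplings_def map_fst_pair_pmf map_snd_pair_pmf)
  hence "wasserstein1 (site_dist {}) Q (gibbs_law {} \<theta>) = 0"
    using wasserstein1_le[of _ Q "gibbs_law {} \<theta>" "site_dist {}"] by (force simp: site_dist_def)
  thus ?case by simp
next
  case (insert k J)
  note J = insert.hyps and \<theta> = insert.prems(1) and D = insert.prems(2-4) and l = insert.prems(5)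
  let ?I = "insert k J"
  let ?P = "gibbs_law ?I \<theta>" and ?R = "\<lambda>n. gibbs_law J (\<lambda>i. \<theta> i * a k i ^ n)"
  let ?up = "\<lambda>n y. y(k := n)"
  define p where "p = map_pmf (\<lambda>x. x k) ?P"
  define q where "q = map_pmf (\<lambda>x. x k) Q"
  \<comment> \<open>The conditional law of \<open>Q\<close> given the value \<open>n\<close> at
    \<open>k\<close>, with \<open>k\<close> erased so that it lives on \<open>confs J\<close>, where
    the induction hypothesis speaks.\<close>
  define S where "S n = map_pmf (\<lambda>x. x(k := 0)) (cond_pmf Q {x. x k = n})" for n
  define \<kappa>1 where "\<kappa>1 = (\<theta> k + (\<theta> k)\<^sup>2 / 4) * phi l"
  define \<kappa>2 where "\<kappa>2 = (\<Sum>i\<in>J. \<theta> i + (\<theta> i)\<^sup>2 / 4) * phi l"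
  have \<kappa>: "0 \<le> \<kappa>1" "0 \<le> \<kappa>2"
    unfolding \<kappa>1_def \<kappa>2_def using \<theta> phi_nonneg by (auto intro!: mult_nonneg_nonneg sum_nonneg)
  have ne: "set_pmf Q \<inter> {x. x k = n} \<noteq> {}" if "n \<in> set_pmf q" for n using that by (auto simp: q_def)
  have pw: "a k i ^ n \<le> 1" "0 \<le> a k i ^ n" for i n
    by (simp_all add: a_nonneg a_le_1 power_le_one)
  have \<theta>n: "\<forall>i\<in>J. 0 \<le> \<theta> i * a k i ^ n" for n using \<theta> pw by simp
  have \<theta>n_le: "\<theta> i * a k i ^ n \<le> \<theta> i" if "i \<in> J" for i n using that \<theta> pw[of i n] by (intro mult_left_le) auto
  have Pdis: "bind_pmf p (\<lambda>n. map_pmf (?up n) (?R n)) = ?P"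
    unfolding p_def by (rule gibbs_law_disintegration[OF J \<theta>])
  have Qdis: "bind_pmf q (\<lambda>n. map_pmf (?up n) (S n)) = Q"
  proof -
    have "bind_pmf q (\<lambda>n. map_pmf (?up n) (S n)) = bind_pmf q (\<lambda>n. cond_pmf Q {x. x k = n})"
    proof (rule bind_pmf_cong[OF refl])
      fix n assume "n \<in> set_pmf q"
      have "map_pmf (?up n) (S n) = map_pmf (\<lambda>x. x(k := n)) (cond_pmf Q {x. x k = n})"
        by (simp add: S_def map_pmf_comp)
      also have "\<dots> = cond_pmf Q {x. x k = n}"
        by (rule map_pmf_idI) (use ne[OF \<open>n \<in> set_pmf q\<close>] in auto)
      finally show "map_pmf (?up n) (S n) = cond_pmf Q {x. x k = n}" .
    qed
    thus ?thesis using bind_cond_pmf_fibre[of "\<lambda>x. x k" Q] by (simp add: q_def)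
  qed
  have S_conf: "set_pmf (S n) \<subseteq> confs J" if "n \<in> set_pmf q" for n
    using ne[OF that] insert.prems(6) J(2) by (auto simp: S_def confs_insert_iff)
  have IH: "ennreal l * (ennreal (1 - D) * wasserstein1 (site_dist J) (S n) (?R n))
      \<le> entropy_dual (map_pmf (?up n) (S n)) (map_pmf (?up n) (?R n)) \<kappa>2" if n: "n \<in> set_pmf q" for n
  proof -
    have "(\<Sum>i\<in>J. \<theta> i * a k i ^ n * (1 - a i j)) \<le> D" if "j \<in> J" for j
    proof -
      have "(\<Sum>i\<in>J. \<theta> i * a k i ^ n * (1 - a i j)) \<le> (\<Sum>i\<in>J. \<theta> i * (1 - a i j))"
        by (intro sum_mono mult_right_mono \<theta>n_le) (auto simp: a_le_1)
      also have "\<dots> \<le> (\<Sum>i\<in>?I. \<theta> i * (1 - a i j))" using J \<theta> a_le_1 by simp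
      also have "\<dots> \<le> D" using D(1) that by blast
      finally show ?thesis .
    qed
    hence "ennreal l * (ennreal (1 - D) * wasserstein1 (site_dist J) (S n) (?R n))
      \<le> entropy_dual (S n) (?R n) ((\<Sum>i\<in>J. \<theta> i * a k i ^ n + (\<theta> i * a k i ^ n)\<^sup>2 / 4) * phi l)"
      by (intro insert.IH \<theta>n D l S_conf n) auto
    also have "\<dots> \<le> entropy_dual (S n) (?R n) \<kappa>2"
      unfolding \<kappa>2_def using \<theta>n \<theta>n_le
      by (intro entropy_dual_mono mult_right_mono phi_nonneg sum_mono add_mono divide_right_mono power_mono) auto
    also have "\<dots> \<le> entropy_dual (map_pmf (?up n) (S n)) (map_pmf (?up n) (?R n)) \<kappa>2"
    proof (rule entropy_dual_map_pmf[where r = "\<lambda>x. x(k := 0)"])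
      fix x assume "x \<in> set_pmf (S n) \<union> set_pmf (?R n)"
      hence "x \<in> confs J" using S_conf[OF n] set_gibbs_law[OF J(1) \<theta>n] by auto
      thus "(?up n x)(k := 0) = x" using J by (auto simp: confs_def fun_eq_iff)
    qed
    finally show ?thesis .
  qed
  let ?c = "\<integral>\<^sup>+n. ennreal (1 - D) * wasserstein1 (site_dist J) (S n) (?R n) \<partial>measure_pmf q"
  \<comment> \<open>The triangle inequality goes through \<open>?R n\<close>: the leg from
    \<open>S n\<close> to \<open>?R n\<close> compares conditional laws at the same value and is
    left to the induction hypothesis, while the leg from \<open>?R n\<close> to \<open>?R m\<close>
    costs at most \<open>D * nat_dist n m\<close>.\<close>
  have split: "ennreal (1 - D) * wasserstein1 (site_dist ?I) Q ?P \<le> wasserstein1 nat_dist q p + ?c"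
  proof (rule le_wasserstein1_add)
    fix \<pi> assume \<pi>: "\<pi> \<in> couplings q p"
    have pt: "ennreal (1 - D) * wasserstein1 (site_dist ?I) (map_pmf (?up n) (S n)) (map_pmf (?up m) (?R m))
       \<le> ennreal (nat_dist n m) + ennreal (1 - D) * wasserstein1 (site_dist J) (S n) (?R n)" for n m
    proof -
      have "wasserstein1 (site_dist ?I) (map_pmf (?up n) (S n)) (map_pmf (?up m) (?R m))
         \<le> ennreal (nat_dist n m) + wasserstein1 (site_dist J) (S n) (?R m)"
        by (rule wasserstein1_site_dist_insert[OF J])
      also have "\<dots> \<le> ennreal (nat_dist n m) + (wasserstein1 (site_dist J) (S n) (?R n) + wasserstein1 (site_dist J) (?R n) (?R m))"
        by (intro add_left_mono wasserstein1_triangle site_dist_nonneg site_dist_triangle)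
      finally have "ennreal (1 - D) * wasserstein1 (site_dist ?I) (map_pmf (?up n) (S n)) (map_pmf (?up m) (?R m))
         \<le> ennreal (1 - D) * (ennreal (nat_dist n m) + (wasserstein1 (site_dist J) (S n) (?R n) + wasserstein1 (site_dist J) (?R n) (?R m)))"
        by (rule mult_left_mono) simp
      also have "\<dots> = (ennreal ((1 - D) * nat_dist n m) + ennreal (1 - D) * wasserstein1 (site_dist J) (?R n) (?R m))
           + ennreal (1 - D) * wasserstein1 (site_dist J) (S n) (?R n)"
        using D by (simp add: distrib_left ac_simps ennreal_mult)
      also have "\<dots> \<le> (ennreal ((1 - D) * nat_dist n m) + ennreal (D * nat_dist n m))
           + ennreal (1 - D) * wasserstein1 (site_dist J) (S n) (?R n)"
        by (intro add_right_mono add_left_mono gibbs_law_site_lipschitz[OF J \<theta> D])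
      also have "ennreal ((1 - D) * nat_dist n m) + ennreal (D * nat_dist n m) = ennreal (nat_dist n m)"
        using D(2,3) by (subst ennreal_plus[symmetric]) (auto simp: left_diff_distrib mult_left_le_one_le)
      finally show ?thesis .
    qed
    have "ennreal (1 - D) * wasserstein1 (site_dist ?I) Q ?P
       \<le> ennreal (1 - D) * (\<integral>\<^sup>+nm. wasserstein1 (site_dist ?I) (map_pmf (?up (fst nm)) (S (fst nm)))
            (map_pmf (?up (snd nm)) (?R (snd nm))) \<partial>measure_pmf \<pi>)"
      using wasserstein1_bind_pmf[OF \<pi>, of "site_dist ?I" "\<lambda>n. map_pmf (?up n) (S n)" "\<lambda>n. map_pmf (?up n) (?R n)"]
      unfolding Qdis Pdis by (rule mult_left_mono) simp
    also have "\<dots> = (\<integral>\<^sup>+nm. ennreal (1 - D) * wasserstein1 (site_dist ?I) (map_pmf (?up (fst nm)) (S (fst nm)))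
            (map_pmf (?up (snd nm)) (?R (snd nm))) \<partial>measure_pmf \<pi>)"
      by (rule nn_integral_cmult[symmetric]) simp
    also have "\<dots> \<le> (\<integral>\<^sup>+nm. ennreal (nat_dist (fst nm) (snd nm))
         + ennreal (1 - D) * wasserstein1 (site_dist J) (S (fst nm)) (?R (fst nm)) \<partial>measure_pmf \<pi>)"
      by (intro nn_integral_mono pt)
    \<comment> \<open>The second term depends on the first coordinate only, so it is the same for
      every coupling and the infimum falls on the first term alone.\<close>
    also have "\<dots> = transport_cost nat_dist \<pi>
         + (\<integral>\<^sup>+n. ennreal (1 - D) * wasserstein1 (site_dist J) (S n) (?R n) \<partial>measure_pmf (map_pmf fst \<pi>))"
      by (simp add: nn_integral_add)
    also have "map_pmf fst \<pi> = q" using \<pi> by (simp add: couplings_def)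
    finally show "ennreal (1 - D) * wasserstein1 (site_dist ?I) Q ?P \<le> transport_cost nat_dist \<pi> + ?c" .
  qed
  have mgf: "lipschitz_mgf l \<kappa>1 p"
  proof -
    have "0 \<le> \<theta> k * damping ?I k x \<and> \<theta> k * damping ?I k x \<le> \<theta> k" for x
      using \<theta> damping_bounds[of ?I k x] by (simp add: mult_left_le)
    moreover have "p = bind_pmf ?P (\<lambda>x. poisson_law (\<theta> k * damping ?I k x))"
      unfolding p_def by (rule gibbs_law_marginal) (use J \<theta> in auto)
    ultimately show ?thesis unfolding \<kappa>1_def
      using lipschitz_mgf_mixed_poisson_law[of "\<lambda>x. \<theta> k * damping ?I k x" "\<theta> k" l ?P] l by simp
  qed
  have "ennreal l * (ennreal (1 - D) * wasserstein1 (site_dist ?I) Q ?P) \<le> ennreal l * (wasserstein1 nat_dist q p + ?c)"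
    by (rule mult_left_mono[OF split]) simp
  also have "\<dots> = ennreal l * wasserstein1 nat_dist q p
       + (\<integral>\<^sup>+n. ennreal l * (ennreal (1 - D) * wasserstein1 (site_dist J) (S n) (?R n)) \<partial>measure_pmf q)"
    by (simp add: distrib_left nn_integral_cmult)
  also have "\<dots> \<le> entropy_dual q p \<kappa>1
       + (\<integral>\<^sup>+n. entropy_dual (map_pmf (?up n) (S n)) (map_pmf (?up n) (?R n)) \<kappa>2 \<partial>measure_pmf q)"
    by (intro add_mono wasserstein1_nat_le_entropy_dual mgf l nn_integral_mono_AE) (simp add: AE_measure_pmf_iff IH)
  also have "\<dots> \<le> entropy_dual (bind_pmf q (\<lambda>n. map_pmf (?up n) (S n))) (bind_pmf p (\<lambda>n. map_pmf (?up n) (?R n))) (\<kappa>1 + \<kappa>2)"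
    by (rule entropy_dual_superadditive[where f = "\<lambda>x. x k"]) (use \<kappa> in auto)
  also have "\<dots> = entropy_dual Q ?P ((\<Sum>i\<in>?I. \<theta> i + (\<theta> i)\<^sup>2 / 4) * phi l)"
    unfolding Qdis Pdis \<kappa>1_def \<kappa>2_def using J by (simp add: distrib_right)
  finally show ?case .
qed

end

section \<open>Donsker--Varadhan inequality\<close>

text \<open>Pointwise \<open>G - f - \<kappa> \<le> exp (G - f - \<kappa>) - 1\<close>. On the
  support of \<open>Q\<close> the exponential is \<open>exp (G - \<kappa>)\<close> times the density
  ratio of \<open>P\<close> to \<open>Q\<close>, so its mean under \<open>Q\<close> is at most
  1.\<close>

lemma entropy_dual_le_rel_entropy:
  assumes \<kappa>: "0 \<le> \<kappa>"
  shows "enn2ereal (entropy_dual Q P \<kappa>) \<le> rel_entropy Q P + ereal \<kappa>"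
proof (cases "set_pmf Q \<subseteq> set_pmf P")
  case False
  thus ?thesis by (simp add: rel_entropy_def)
next
  case True
  define f where "f x = ln (pmf Q x / pmf P x)" for x
  let ?A = "\<integral>\<^sup>+x. ennreal (f x) \<partial>measure_pmf Q" and ?B = "\<integral>\<^sup>+x. ennreal (- f x) \<partial>measure_pmf Q"
  have H: "rel_entropy Q P = enn2ereal ?A - enn2ereal ?B"
    using True by (simp add: rel_entropy_def f_def[abs_def])
  have pos: "0 < pmf Q x" "0 < pmf P x" if "x \<in> set_pmf Q" for x
    using that True by (auto simp: pmf_positive)
  \<comment> \<open>Only an inequality, because \<open>P\<close> may charge points outside the
    support of \<open>Q\<close>.\<close>
  have change: "(\<integral>\<^sup>+x. ennreal (g x * pmf P x / pmf Q x) \<partial>measure_pmf Q) \<le> (\<integral>\<^sup>+x. ennreal (g x) \<partial>measure_pmf P)"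
    if g: "\<And>x. 0 \<le> g x" for g
  proof -
    have "(\<integral>\<^sup>+x. ennreal (g x * pmf P x / pmf Q x) \<partial>measure_pmf Q)
       = (\<integral>\<^sup>+x. ennreal (pmf Q x) * ennreal (g x * pmf P x / pmf Q x) \<partial>count_space UNIV)"
      by (rule nn_integral_measure_pmf)
    also have "\<dots> \<le> (\<integral>\<^sup>+x. ennreal (pmf P x) * ennreal (g x) \<partial>count_space UNIV)"
    proof (rule nn_integral_mono)
      fix x
      have "pmf Q x * (g x * pmf P x / pmf Q x) \<le> pmf P x * g x"
        using g[of x] by (cases "pmf Q x = 0") auto
      thus "ennreal (pmf Q x) * ennreal (g x * pmf P x / pmf Q x) \<le> ennreal (pmf P x) * ennreal (g x)"
        using g[of x] by (simp add: ennreal_leI flip: ennreal_mult)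
    qed
    also have "\<dots> = (\<integral>\<^sup>+x. ennreal (g x) \<partial>measure_pmf P)" by (rule nn_integral_measure_pmf[symmetric])
    finally show ?thesis .
  qed
  \<comment> \<open>The negative part of the log-density is dominated by
    \<open>pmf P x / pmf Q x\<close>, whose mean is at most 1; so the difference defining the
    entropy is never infinity minus infinity.\<close>
  have "?B \<le> (\<integral>\<^sup>+x. ennreal (1 * pmf P x / pmf Q x) \<partial>measure_pmf Q)"
  proof (intro nn_integral_mono_AE, unfold AE_measure_pmf_iff, intro ballI ennreal_leI)
    fix x assume "x \<in> set_pmf Q"
    hence "- f x = ln (pmf P x / pmf Q x)" using pos[of x] by (simp add: f_def ln_div)
    also have "\<dots> \<le> pmf P x / pmf Q x - 1" using pos[OF \<open>x \<in> set_pmf Q\<close>] by (intro ln_le_minus_one) simp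
    finally show "- f x \<le> 1 * pmf P x / pmf Q x" by simp
  qed
  also have "\<dots> \<le> 1" using change[of "\<lambda>_. 1"] by simp
  finally have B: "?B < top" using ennreal_one_less_top le_less_trans by blast
  show ?thesis
  proof (cases "?A = top")
    case True
    hence "rel_entropy Q P = \<infinity>" using B unfolding H by (cases ?B) (auto simp: enn2ereal_ennreal)
    thus ?thesis by simp
  next
    case False
    hence A: "?A < top" by (simp add: less_top)
    have If: "integrable (measure_pmf Q) f"
      unfolding real_integrable_def using A B by (auto simp: less_top)
    define h where "h = measure_pmf.expectation Q f"
    have Hh: "rel_entropy Q P = ereal h"
    proof -
      have "enn2ereal X = ereal (enn2real X)" if "X < top" for X
        using that by (cases X) (auto simp: enn2ereal_ennreal)
      thus ?thesis using A B unfolding H h_def real_lebesgue_integral_def[OF If] by simp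
    qed
    have key: "measure_pmf.expectation Q G \<le> h + \<kappa>"
      if BG: "\<And>x. \<bar>G x\<bar> \<le> B" and EG: "measure_pmf.expectation P (\<lambda>x. exp (G x)) \<le> exp \<kappa>" for G B
    proof -
      define u where "u x = exp (G x - \<kappa>) * pmf P x / pmf Q x" for x
      have u0: "0 \<le> u x" for x by (simp add: u_def)
      have IG: "integrable (measure_pmf Q) G" by (rule integrable_measure_pmf_bounded[OF BG])
      have Ie: "integrable (measure_pmf P) (\<lambda>x. exp (G x))"
        using integrable_exp_bounded[of G B 1 P] BG by simp
      have "(\<integral>\<^sup>+x. ennreal (u x) \<partial>measure_pmf Q) \<le> (\<integral>\<^sup>+x. ennreal (exp (G x - \<kappa>)) \<partial>measure_pmf P)"
        unfolding u_def by (rule change) simp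
      also have "\<dots> = ennreal (measure_pmf.expectation P (\<lambda>x. exp (G x - \<kappa>)))"
        using Ie by (intro nn_integral_eq_integral) (auto simp: exp_diff)
      also have "\<dots> \<le> ennreal 1"
        using EG by (intro ennreal_leI) (simp add: exp_diff divide_le_eq)
      finally have u1: "(\<integral>\<^sup>+x. ennreal (u x) \<partial>measure_pmf Q) \<le> 1" by simp
      hence Iu: "integrable (measure_pmf Q) u"
        by (intro integrableI_nonneg) (use u0 in \<open>auto intro: le_less_trans\<close>)
      have "ennreal (measure_pmf.expectation Q u) \<le> 1"
        using u1 nn_integral_eq_integral[OF Iu] u0 by simp
      hence Eu: "measure_pmf.expectation Q u \<le> 1" by simp
      have "measure_pmf.expectation Q (\<lambda>x. G x - f x - \<kappa>) \<le> measure_pmf.expectation Q (\<lambda>x. u x - 1)"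
      proof (intro integral_mono_AE)
        show "AE x in measure_pmf Q. G x - f x - \<kappa> \<le> u x - 1"
          unfolding AE_measure_pmf_iff
        proof
          fix x assume x: "x \<in> set_pmf Q"
          have "u x = exp (G x - f x - \<kappa>)"
            using pos[OF x] by (simp add: u_def f_def exp_diff)
          thus "G x - f x - \<kappa> \<le> u x - 1" using exp_ge_add_one_self[of "G x - f x - \<kappa>"] by linarith
        qed
      qed (use IG If Iu in auto)
      thus ?thesis using IG If Iu Eu by (simp add: h_def)
    qed
    have h0: "0 \<le> h + \<kappa>" using key[of "\<lambda>_. 0" 0] \<kappa> by simp
    have "entropy_dual Q P \<kappa> \<le> ennreal (h + \<kappa>)"
      unfolding entropy_dual_def
    proof (rule SUP_least)
      fix G assume G: "G \<in> entropy_admissible Q P \<kappa>"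
      obtain B where "\<And>x. \<bar>G x\<bar> \<le> B" using entropy_admissibleD(1)[OF G] by blast
      from key[OF this entropy_admissibleD(2)[OF G]] show "ennreal (measure_pmf.expectation Q G) \<le> ennreal (h + \<kappa>)"
        by (rule ennreal_leI)
    qed
    hence "enn2ereal (entropy_dual Q P \<kappa>) \<le> enn2ereal (ennreal (h + \<kappa>))" by (simp add: less_eq_ennreal.rep_eq)
    also have "\<dots> = rel_entropy Q P + ereal \<kappa>" using h0 by (simp add: enn2ereal_ennreal Hh)
    finally show ?thesis .
  qed
qed

section \<open>Identification of the Gibbs measure\<close>

lemma exp_neg_bounds:
  assumes "0 \<le> e"
  shows "0 \<le> exp_neg e" "exp_neg e \<le> 1"
  using assms by (cases e; auto simp: exp_neg_def)+

lemma exp_neg_add: "0 \<le> x \<Longrightarrow> 0 \<le> y \<Longrightarrow> exp_neg (x + y) = exp_neg x * exp_neg y"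
  by (cases x; cases y) (auto simp: exp_neg_def exp_add[symmetric])

lemma exp_neg_sum:
  assumes "finite A" "\<And>i. i \<in> A \<Longrightarrow> 0 \<le> f i"
  shows "exp_neg (\<Sum>i\<in>A. f i) = (\<Prod>i\<in>A. exp_neg (f i))"
  using assms
proof (induction A rule: finite_induct)
  case empty
  show ?case by (simp add: exp_neg_def)
next
  case (insert i A)
  thus ?case by (simp add: exp_neg_add sum_nonneg)
qed

text \<open>The delicate case is infinite \<open>e\<close> with \<open>m = 0\<close>: the product is
  0, and \<open>0 ^ 0 = 1\<close> makes both sides 1.\<close>

lemma exp_neg_mult_nat: "0 \<le> e \<Longrightarrow> exp_neg (e * ereal (real m)) = exp_neg e ^ m"
  by (cases e; cases "m = 0") (auto simp: exp_neg_def exp_of_nat_mult[symmetric] mult.commute)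

theorem theorem3p3:
  fixes N :: nat and \<delta> :: "nat \<Rightarrow> real" and \<gamma> :: "nat \<Rightarrow> nat \<Rightarrow> ereal"
    and Q :: "(nat \<Rightarrow> nat) pmf"
  assumes "N \<ge> 2"
    and "\<And>i. i \<in> {1..N} \<Longrightarrow> \<delta> i > 0"
    and "\<And>i j. i \<in> {1..N} \<Longrightarrow> j \<in> {1..N} \<Longrightarrow> \<gamma> i j \<ge> 0"
    and "\<And>i j. i \<in> {1..N} \<Longrightarrow> j \<in> {1..N} \<Longrightarrow> \<gamma> i j = \<gamma> j i"
    and "\<And>i. i \<in> {1..N} \<Longrightarrow> \<gamma> i i = 0"
    and "dobrushin N \<delta> \<gamma> < 1"
    and "set_pmf Q \<subseteq> conf N"
  shows "hc_ext (\<Sum>i\<in>{1..N}. \<delta> i + (\<delta> i)\<^sup>2 / 4)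
           (ennreal (1 - dobrushin N \<delta> \<gamma>) * wasserstein1 (hamming_dist N) Q (gibbs_pmf N \<delta> \<gamma>))
         \<le> rel_entropy Q (gibbs_pmf N \<delta> \<gamma>)"
proof -
  let ?I = "{1..N}"
  note \<delta> = assms(2) and \<gamma> = assms(3)
  \<comment> \<open>Weight 1 outside the sites means no interaction, so that the locale assumptions
    hold for all indices.\<close>
  define a where "a i j = (if i \<in> ?I \<and> j \<in> ?I then exp_neg (\<gamma> i j) else 1)" for i j
  interpret interaction a
  proof
    fix i j
    show "0 \<le> a i j" "a i j \<le> 1" unfolding a_def using exp_neg_bounds \<gamma> by auto
    show "a i j = a j i" unfolding a_def using assms(4) by auto
    show "a i i = 1" unfolding a_def using assms(5) by (auto simp: exp_neg_def)
  qed
  define D where "D = dobrushin N \<delta> \<gamma>"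
  define c where "c = (\<Sum>i\<in>?I. \<delta> i + (\<delta> i)\<^sup>2 / 4)"
  have conf: "conf N = confs ?I" by (simp add: conf_def confs_def)
  have ham: "hamming_dist N = site_dist ?I" by (intro ext) (simp add: hamming_dist_def site_dist_def)
  have \<delta>0: "\<forall>i\<in>?I. 0 \<le> \<delta> i" using \<delta> by (auto intro: less_imp_le)
  have weight: "gibbs_weight N \<delta> \<gamma> x = exp (- (\<Sum>i\<in>?I. \<delta> i)) * gibbs_density ?I \<delta> x" if x: "x \<in> conf N" for x
  proof -
    have "exp_neg (energy N \<gamma> x) = exp_neg (\<Sum>p\<in>pairs ?I. \<gamma> (fst p) (snd p) * ereal (real (x (fst p) * x (snd p))))"
      by (simp add: energy_def pairs_def split_beta)
    also have "\<dots> = (\<Prod>p\<in>pairs ?I. exp_neg (\<gamma> (fst p) (snd p) * ereal (real (x (fst p) * x (snd p)))))"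
    proof (rule exp_neg_sum)
      fix p assume "p \<in> pairs ?I"
      hence "0 \<le> \<gamma> (fst p) (snd p)" using \<gamma> by (auto simp: pairs_def)
      thus "0 \<le> \<gamma> (fst p) (snd p) * ereal (real (x (fst p) * x (snd p)))" by (intro ereal_0_le_mult) simp_all
    qed (simp add: finite_pairs)
    also have "\<dots> = (\<Prod>p\<in>pairs ?I. a (fst p) (snd p) ^ (x (fst p) * x (snd p)))"
    proof (rule prod.cong[OF refl])
      fix p assume "p \<in> pairs ?I"
      hence "fst p \<in> ?I" "snd p \<in> ?I" by (auto simp: pairs_def)
      thus "exp_neg (\<gamma> (fst p) (snd p) * ereal (real (x (fst p) * x (snd p))))
         = a (fst p) (snd p) ^ (x (fst p) * x (snd p))"
        by (simp only: exp_neg_mult_nat[OF \<gamma>] a_def simp_thms if_True)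
    qed
    finally have 1: "exp_neg (energy N \<gamma> x) = (\<Prod>(i,j)\<in>pairs ?I. a i j ^ (x i * x j))" by (simp add: split_beta)
    have 2: "(\<Prod>i\<in>?I. poisson_w (\<delta> i) (x i)) = exp (- (\<Sum>i\<in>?I. \<delta> i)) * (\<Prod>i\<in>?I. \<delta> i ^ x i / fact (x i))"
      by (simp add: poisson_w_def exp_sum prod.distrib[symmetric] flip: sum_negf)
    show ?thesis using x unfolding conf unfolding gibbs_weight_def 1 2 gibbs_density_def by simp
  qed
  have gibbs_eq: "gibbs_pmf N \<delta> \<gamma> = gibbs_law ?I \<delta>"
  proof -
    obtain b where b: "\<And>x. pmf (gibbs_law ?I \<delta>) x = b * gibbs_density ?I \<delta> x" using pmf_gibbs_law[of ?I \<delta>] \<delta>0 by auto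
    define e where "e = exp (- (\<Sum>i\<in>?I. \<delta> i))"
    have e: "e \<noteq> 0" by (simp add: e_def)
    \<comment> \<open>Total mass 1 determines the constant \<open>b\<close> as the inverse of the
      summed density; the same sum is \<open>gibbs_const\<close> up to the factor
      \<open>e\<close>.\<close>
    have "infsum (pmf (gibbs_law ?I \<delta>)) UNIV = 1"
      using infsetsum_pmf_eq_1[of "gibbs_law ?I \<delta>" UNIV] infsetsum_infsum[of "pmf (gibbs_law ?I \<delta>)" UNIV] by auto
    hence bZ: "b * infsum (gibbs_density ?I \<delta>) UNIV = 1"
      unfolding b by (subst (asm) infsum_cmult_right') simp
    have "gibbs_const N \<delta> \<gamma> = infsum (\<lambda>x. e * gibbs_density ?I \<delta> x) (conf N)"
      unfolding gibbs_const_def by (rule infsum_cong) (simp add: weight e_def)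
    also have "\<dots> = infsum (\<lambda>x. e * gibbs_density ?I \<delta> x) UNIV"
      by (rule infsum_cong_neutral) (auto simp: conf gibbs_density_def)
    also have "\<dots> = e * infsum (gibbs_density ?I \<delta>) UNIV" by (rule infsum_cmult_right')
    finally have Z: "gibbs_const N \<delta> \<gamma> = e * infsum (gibbs_density ?I \<delta>) UNIV" .
    have "(if x \<in> conf N then gibbs_weight N \<delta> \<gamma> x / gibbs_const N \<delta> \<gamma> else 0) = pmf (gibbs_law ?I \<delta>) x" for x
    proof (cases "x \<in> conf N")
      case True
      let ?Z = "infsum (gibbs_density ?I \<delta>) UNIV"
      have "?Z \<noteq> 0" using bZ by auto
      hence "1 / ?Z = b" using bZ by (simp add: divide_eq_eq)
      have "gibbs_weight N \<delta> \<gamma> x / gibbs_const N \<delta> \<gamma> = e * gibbs_density ?I \<delta> x / (e * ?Z)"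
        unfolding Z weight[OF True] e_def ..
      also have "\<dots> = 1 / ?Z * gibbs_density ?I \<delta> x" using e by simp
      finally show ?thesis unfolding \<open>1 / ?Z = b\<close> b using True by simp
    next
      case False
      thus ?thesis unfolding b gibbs_density_def conf by simp
    qed
    thus ?thesis unfolding gibbs_pmf_def
      using type_definition.Rep_inverse[OF td_pmf_embed_pmf, of "gibbs_law ?I \<delta>"] by presburger
  qed
  have Dj: "\<forall>j\<in>?I. (\<Sum>i\<in>?I. \<delta> i * (1 - a i j)) \<le> D"
  proof
    fix j assume j: "j \<in> ?I"
    have "(\<Sum>i\<in>?I. \<delta> i * (1 - a i j)) = (\<Sum>i\<in>?I. \<delta> i * (1 - exp_neg (\<gamma> i j)))"
      using j by (intro sum.cong) (auto simp: a_def)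
    also have "\<dots> \<le> D" unfolding D_def dobrushin_def by (rule cSUP_upper[OF j]) simp
    finally show "(\<Sum>i\<in>?I. \<delta> i * (1 - a i j)) \<le> D" .
  qed
  \<comment> \<open>One site suffices to see that \<open>D\<close> is nonnegative and
    \<open>c\<close> is positive.\<close>
  have "1 \<in> ?I" using assms(1) by simp
  have "0 \<le> (\<Sum>i\<in>?I. \<delta> i * (1 - a i 1))" using \<delta>0 a_le_1 by (intro sum_nonneg mult_nonneg_nonneg) auto
  hence D0: "0 \<le> D" using bspec[OF Dj \<open>1 \<in> ?I\<close>] by linarith
  have D1: "D < 1" using assms(6) by (simp add: D_def)
  have "0 < \<delta> 1 + (\<delta> 1)\<^sup>2 / 4" using \<delta>[OF \<open>1 \<in> ?I\<close>] by (simp add: add_pos_nonneg)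
  also have "\<dots> \<le> c" unfolding c_def using \<open>1 \<in> ?I\<close> \<delta>0 by (intro member_le_sum) auto
  finally have c: "0 < c" .
  define X where "X = ennreal (1 - D) * wasserstein1 (site_dist ?I) Q (gibbs_law ?I \<delta>)"
  let ?H = "rel_entropy Q (gibbs_law ?I \<delta>)"
  have main: "enn2ereal (ennreal l * X) \<le> ?H + ereal (c * phi l)" if l: "0 \<le> l" for l
  proof -
    have "ennreal l * X \<le> entropy_dual Q (gibbs_law ?I \<delta>) (c * phi l)"
      unfolding X_def c_def by (rule gibbs_law_transport_entropy_dual[OF _ \<delta>0 Dj D0 D1 l]) (use assms(7) conf in auto)
    hence "enn2ereal (ennreal l * X) \<le> enn2ereal (entropy_dual Q (gibbs_law ?I \<delta>) (c * phi l))"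
      by (simp add: less_eq_ennreal.rep_eq)
    also have "\<dots> \<le> ?H + ereal (c * phi l)"
      by (rule entropy_dual_le_rel_entropy) (use c phi_nonneg in simp)
    finally show ?thesis .
  qed
  have "hc_ext c X \<le> ?H"
  proof (cases X)
    \<comment> \<open>If the transport cost is infinite, a single positive slope already forces
      infinite entropy.\<close>
    case top
    hence "?H + ereal (c * phi 1) = \<infinity>" using main[of 1] by simp
    hence "?H = \<infinity>" by (cases ?H) auto
    thus ?thesis by simp
  next
    case (real r)
    \<comment> \<open>The maximiser of \<open>l * r - c * phi l\<close>, found from
      \<open>exp l = 1 + r / c\<close>; the maximum is \<open>c * hfun (r / c)\<close>.\<close>
    define l where "l = ln (1 + r / c)"
    have el: "exp l = 1 + r / c" unfolding l_def using real c by (intro exp_ln) (simp add: add_pos_nonneg)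
    have l: "0 \<le> l" unfolding l_def using real c by simp
    have "enn2ereal (ennreal l * X) = ereal (l * r)"
      using real l by (simp add: enn2ereal_ennreal flip: ennreal_mult)
    hence "ereal (l * r) \<le> ?H + ereal (c * phi l)" using main[OF l] by simp
    hence "ereal (l * r - c * phi l) \<le> ?H" by (cases ?H) auto
    moreover have "l * r - c * phi l = c * hfun (r / c)"
      using c unfolding phi_def el hfun_def l_def[symmetric] by (simp add: field_simps)
    ultimately show ?thesis using real by (simp add: hc_ext_def)
  qed
  thus ?thesis by (simp add: c_def X_def D_def ham gibbs_eq)
qed

end
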